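(* For each $n$ let $M=M_n$ be a random $n\times n$ matrix whose entries are independent, each equal to $1$ with probability $p=p(n)$ and $0$ otherwise, where $0\le p=\frac{1}{n}(\log n+c_n)\le \frac12$ for a real sequence $(c_n)$. (a) If $c_n\to\infty$ as $n\to\infty$, then with high probability $M$ is strongly reconstructible from the collection of its rows and columns. (b) If $c_n\to-\infty$ as $n\to\infty$, then with high probability $M$ is not strongly reconstructible from the collection of its rows and columns. (c) If $c_n\to c\in\mathbb{R}$ as $n\to\infty$, then the probability that $M$ is strongly reconstructible tends to an explicit constant, depending only on $c$, that is strictly between $0$ and $1$.
   Context: For an $n\times n$ binary matrix $M$, let $\mathcal{R}$ and $\mathcal{C}$ be the multisets of the $n$ binary strings of length $n$ that are the rows, respectively the columns, of $M$. $M$ is (weakly) reconstructible if every $n\times n$ binary matrix with the same multiset of rows and the same multiset of columns as $M$ equals $M$. $M$ is strongly reconstructible if the positions of all rows and columns are determined by $\mathcal{R}$ and $\mathcal{C}$, that is, for each row $r=(r_1,\dots,r_n)\in\mathcal{R}$ one can determine from $\mathcal{R}$ and $\mathcal{C}$ a unique $i$ such that $M_{i,j}=r_j$ for all $j$, and similarly for columns. Equivalently, $M$ is strongly reconstructible if and only if $M$ is weakly reconstructible and has no two identical rows and no two identical columns. An event $E=E_n$ happens with high probability if $\mathbb{P}(E_n)\to1$ as $n\to\infty$. Logarithms are natural. *)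

theory Defs
  imports
    "HOL-Probability.Probability"
    "Jordan_Normal_Form.Matrix"
begin

definition same_lines :: "'a mat \<Rightarrow> 'a mat set" where
  "same_lines M = {N \<in> carrier_mat (dim_row M) (dim_col M).
     mset (rows N) = mset (rows M) \<and> mset (cols N) = mset (cols M)}"

definition weakly_reconstructible :: "'a mat \<Rightarrow> bool" where
  "weakly_reconstructible M \<longleftrightarrow> (\<forall>N \<in> same_lines M. N = M)"

text \<open>A position depends on the two multisets alone precisely when it is the same in every
  matrix of \<^term>\<open>same_lines M\<close>; in each of them the line must occur there and nowhere else.\<close>

definition strongly_reconstructible :: "'a mat \<Rightarrow> bool" where
  "strongly_reconstructible M \<longleftrightarrow>
     (\<forall>r \<in># mset (rows M). \<exists>i<dim_row M. \<forall>N \<in> same_lines M.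
        \<forall>k<dim_row M. row N k = r \<longleftrightarrow> k = i) \<and>
     (\<forall>s \<in># mset (cols M). \<exists>j<dim_col M. \<forall>N \<in> same_lines M.
        \<forall>k<dim_col M. col N k = s \<longleftrightarrow> k = j)"

lemma self_in_same_lines: "M \<in> same_lines M"
  by (auto simp: same_lines_def)

lemma strongly_reconstructible_iff:
  "strongly_reconstructible M \<longleftrightarrow>
     weakly_reconstructible M \<and> distinct (rows M) \<and> distinct (cols M)"
proof
  assume S: "strongly_reconstructible M"
  have R: "\<exists>i<dim_row M. \<forall>N \<in> same_lines M. \<forall>k<dim_row M. row N k = row M l \<longleftrightarrow> k = i"
    if "l < dim_row M" for l
    using S that unfolding strongly_reconstructible_def by (auto simp: rows_def)
  have C: "\<exists>i<dim_col M. \<forall>N \<in> same_lines M. \<forall>k<dim_col M. col N k = col M l \<longleftrightarrow> k = i"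
    if "l < dim_col M" for l
    using S that unfolding strongly_reconstructible_def by (auto simp: cols_def)
  have C': "k = l" if "k < dim_col M" "l < dim_col M" "col M k = col M l" for k l
    using C[OF that(2)] that self_in_same_lines[of M] by blast
  have R': "k = l" if "k < dim_row M" "l < dim_row M" "row M k = row M l" for k l
    using R[OF that(2)] that self_in_same_lines[of M] by blast
  have "distinct (rows M)"
    using R' by (auto simp: distinct_conv_nth rows_def)
  moreover have "distinct (cols M)"
    using C' by (auto simp: distinct_conv_nth cols_def)
  moreover have "N = M" if N: "N \<in> same_lines M" for N
  proof (rule eq_rowI)
    show "dim_row N = dim_row M" "dim_col N = dim_col M"
      using N by (auto simp: same_lines_def)
    show "row N i = row M i" if "i < dim_row M" for i
      using R[OF that] N self_in_same_lines that by metis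
  qed
  ultimately show "weakly_reconstructible M \<and> distinct (rows M) \<and> distinct (cols M)"
    by (auto simp: weakly_reconstructible_def)
next
  assume W: "weakly_reconstructible M \<and> distinct (rows M) \<and> distinct (cols M)"
  then have "same_lines M = {M}"
    using self_in_same_lines by (auto simp: weakly_reconstructible_def)
  moreover have "row M k = row M i \<longleftrightarrow> k = i" if "k < dim_row M" "i < dim_row M" for k i
    using W that nth_eq_iff_index_eq[of "rows M" k i] by (simp add: rows_def)
  moreover have "col M k = col M i \<longleftrightarrow> k = i" if "k < dim_col M" "i < dim_col M" for k i
    using W that nth_eq_iff_index_eq[of "cols M" k i] by (simp add: cols_def)
  ultimately show "strongly_reconstructible M"
    unfolding strongly_reconstructible_def by (auto simp: rows_def cols_def)
qed

definition random_matrix :: "nat \<Rightarrow> real \<Rightarrow> bool mat pmf" where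
  "random_matrix n q =
     map_pmf (mat n n) (Pi_pmf ({..<n} \<times> {..<n}) False (\<lambda>_. bernoulli_pmf q))"

text \<open>In the critical window the numbers of zero rows and of zero columns are asymptotically
  independent Poisson variables of mean \<open>exp (- c)\<close>. The only obstruction of non-vanishing
  probability is that one of them is at least 2.\<close>

definition critical_limit :: "real \<Rightarrow> real" where
  "critical_limit c = ((1 + exp (- c)) * exp (- exp (- c)))\<^sup>2"

end

theory Submission
  imports Defs "HOL-Real_Asymp.Real_Asymp"
begin

text \<open>
  A matrix with the same rows and the same columns as \<open>M\<close> is obtained from \<open>M\<close> both by permuting its
  rows and by permuting its columns. So \<open>M\<close> is strongly reconstructible exactly if it has no
  nontrivial automorphism, that is, no pair \<open>(\<pi>, \<sigma>) \<noteq> (id, id)\<close> of permutations such that the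
  entries at \<open>(\<pi> i, \<sigma> j)\<close> and \<open>(i, j)\<close> always agree. Two zero rows, or two zero columns, produce
  one. The proof shows that nothing else does with non-vanishing probability, and determines the
  probability of having at most one zero row and at most one zero column.

  The first point is the lemma \<open>reconstructible_if_few_zero_lines_whp\<close>, valid whenever
  \<open>n * p - ln n\<close> is bounded below. Call a row or column light if it has fewer than \<open>12 * d\<close> ones. With
  high probability no two light lines on the same side have a common neighbour and no light row meets
  a light column in a one. If there is also at most one zero line on each side, then an automorphism
  moves at least as many heavy as light lines, so if it moves \<open>m\<close> lines
  there are at least \<open>3 * d * m\<close> ones in the moved cells
  (\<open>many_ones_in_moved_cells\<close>). For a fixed pair of permutations this has probability at most
  \<open>3 * (p ^ d) ^ m\<close>: a third of these ones lie in a set of cells disjoint from its image, and each of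
  them must be copied to a fresh cell (\<open>prob_invariant_ones_le\<close>). The sum over all nontrivial pairs is
  at most \<open>3 * ((1 + p ^ d) ^ (2 * n ^ 2) - 1)\<close>, because a permutation is encoded by the off-diagonal
  part of its graph, and this tends to 0 if \<open>n ^ 2 * p ^ d\<close> does. The choice \<open>d = 3\<close> works while
  \<open>n * p \<le> 100 * ln n\<close>, and \<open>d\<close> about \<open>4 * ln n\<close> for larger \<open>p\<close>.

  Zero lines are counted as follows. The mean number of zero rows is
  \<open>n * (1 - p) ^ n\<close>. It tends to 0 if \<open>c n\<close> tends to infinity, so that zero lines disappear. It tends
  to infinity if \<open>c n\<close> tends to minus infinity; as the rows are independent, the number of zero rows is
  binomial and exceeds 1 with high probability. It tends to \<open>exp (- \<gamma>)\<close> in the critical window. There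
  an inclusion-exclusion over the sets of zero columns, given which the rows are still independent,
  leads to a sum that converges term by term to a product of two Poisson probabilities
  (\<open>prob_few_zero_lines\<close>, \<open>prob_few_zero_lines_limit\<close>).
\<close>

section \<open>Automorphisms of a binary matrix\<close>

text \<open>Regarding the ones as the edges of a bipartite graph on rows and columns, these are the graph
  automorphisms that keep the two sides.\<close>

definition matrix_automorphism :: "nat \<Rightarrow> (nat \<times> nat \<Rightarrow> bool) \<Rightarrow> (nat \<Rightarrow> nat) \<Rightarrow> (nat \<Rightarrow> nat) \<Rightarrow> bool" where
  "matrix_automorphism n f \<pi> \<sigma> \<longleftrightarrow> \<pi> permutes {..<n} \<and> \<sigma> permutes {..<n} \<and>
     (\<forall>i<n. \<forall>j<n. f (\<pi> i, \<sigma> j) = f (i, j))"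

definition zero_rows :: "nat \<Rightarrow> (nat \<times> nat \<Rightarrow> bool) \<Rightarrow> nat set" where
  "zero_rows n f = {i. i < n \<and> (\<forall>j<n. \<not> f (i, j))}"

definition zero_cols :: "nat \<Rightarrow> (nat \<times> nat \<Rightarrow> bool) \<Rightarrow> nat set" where
  "zero_cols n f = {j. j < n \<and> (\<forall>i<n. \<not> f (i, j))}"

definition few_zero_lines :: "nat \<Rightarrow> (nat \<times> nat \<Rightarrow> bool) \<Rightarrow> bool" where
  "few_zero_lines n f \<longleftrightarrow> card (zero_rows n f) \<le> 1 \<and> card (zero_cols n f) \<le> 1"

lemma zero_cols_swap: "zero_cols n f = zero_rows n (f \<circ> prod.swap)"
  by (auto simp: zero_cols_def zero_rows_def)

lemma finite_zero_lines [simp, intro]: "finite (zero_rows n f)" "finite (zero_cols n f)"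
  by (auto simp: zero_cols_def zero_rows_def)

text \<open>A matrix with the same rows and the same columns as \<open>M\<close> arises from \<open>M\<close> by some row permutation
  and also by some column permutation; undoing the second after the first is an automorphism, and
  it is nontrivial as soon as the matrix differs from \<open>M\<close>. Two equal lines give a transposition.\<close>

lemma automorphism_if_not_strongly_reconstructible:
  assumes "\<not> strongly_reconstructible (mat n n f)"
  shows "\<exists>\<pi> \<sigma>. matrix_automorphism n f \<pi> \<sigma> \<and> (\<pi>, \<sigma>) \<noteq> (id, id)"
proof -
  let ?M = "mat n n f"
  consider "\<not> distinct (rows ?M)" | "\<not> distinct (cols ?M)" | "\<not> weakly_reconstructible ?M"
    using assms by (auto simp: strongly_reconstructible_iff)
  then show ?thesis
  proof cases
    case 1
    then obtain i k where ik: "i < n" "k < n" "i \<noteq> k" "row ?M i = row ?M k"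
      by (auto simp: distinct_conv_nth)
    then have "f (i, j) = f (k, j)" if "j < n" for j
      using that by (metis dim_col_mat(1) dim_row_mat(1) index_mat(1) index_row(1) old.prod.case)
    with ik have "matrix_automorphism n f (Transposition.transpose i k) id"
      by (auto simp: matrix_automorphism_def permutes_swap_id permutes_id Transposition.transpose_def)
    then show ?thesis using ik(3)
      by (metis id_apply prod.inject Transposition.transpose_apply_first)
  next
    case 2
    then obtain i k where ik: "i < n" "k < n" "i \<noteq> k" "col ?M i = col ?M k"
      by (auto simp: distinct_conv_nth)
    then have "f (j, i) = f (j, k)" if "j < n" for j
      using that by (metis dim_col_mat(1) dim_row_mat(1) index_mat(1) index_col old.prod.case)
    with ik have "matrix_automorphism n f id (Transposition.transpose i k)"
      by (auto simp: matrix_automorphism_def permutes_swap_id permutes_id Transposition.transpose_def)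
    then show ?thesis using ik(3)
      by (metis id_apply prod.inject Transposition.transpose_apply_first)
  next
    case 3
    then obtain N where N: "N \<in> carrier_mat n n" "mset (rows N) = mset (rows ?M)"
      "mset (cols N) = mset (cols ?M)" "N \<noteq> ?M"
      by (auto simp: weakly_reconstructible_def same_lines_def)
    obtain \<pi> where \<pi>: "\<pi> permutes {..<n}" "permute_list \<pi> (rows ?M) = rows N"
      using mset_eq_permutation[OF N(2)] by auto
    obtain \<sigma> where \<sigma>: "\<sigma> permutes {..<n}" "permute_list \<sigma> (cols ?M) = cols N"
      using mset_eq_permutation[OF N(3)] by auto
    have lt: "\<pi> i < n" "\<sigma> i < n" if "i < n" for i
      using that \<pi>(1) \<sigma>(1) by (metis lessThan_iff permutes_in_image)+
    have row: "N $$ (i, j) = f (\<pi> i, j)" if "i < n" "j < n" for i j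
    proof -
      have "row N i = rows N ! i" using N(1) that by simp
      also have "\<dots> = row ?M (\<pi> i)"
        using \<pi> that lt by (subst \<pi>(2)[symmetric], subst permute_list_nth) auto
      finally have "row N i $ j = row ?M (\<pi> i) $ j" by simp
      then show ?thesis using N(1) that lt by auto
    qed
    have col: "N $$ (i, j) = f (i, \<sigma> j)" if "i < n" "j < n" for i j
    proof -
      have "col N j = cols N ! j" using N(1) that by simp
      also have "\<dots> = col ?M (\<sigma> j)"
        using \<sigma> that lt by (subst \<sigma>(2)[symmetric], subst permute_list_nth) auto
      finally have "col N j $ i = col ?M (\<sigma> j) $ i" by simp
      then show ?thesis using N(1) that lt by auto
    qed
    have "matrix_automorphism n f \<pi> (Hilbert_Choice.inv \<sigma>)"
      unfolding matrix_automorphism_def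
    proof (intro conjI allI impI)
      show "\<pi> permutes {..<n}" "Hilbert_Choice.inv \<sigma> permutes {..<n}"
        using \<pi> \<sigma> by (auto intro: permutes_inv)
      fix i j assume ij: "i < n" "j < n"
      then have "Hilbert_Choice.inv \<sigma> j < n"
        using \<sigma>(1) by (metis lessThan_iff permutes_in_image permutes_inv)
      then have "f (\<pi> i, Hilbert_Choice.inv \<sigma> j) = f (i, \<sigma> (Hilbert_Choice.inv \<sigma> j))"
        using row col ij by metis
      then show "f (\<pi> i, Hilbert_Choice.inv \<sigma> j) = f (i, j)"
        using \<sigma>(1) by (simp add: permutes_inverses)
    qed
    moreover have "\<pi> \<noteq> id"
    proof
      assume "\<pi> = id"
      then have "N = ?M" using row N(1) by (intro eq_matI) auto
      with N(4) show False by simp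
    qed
    ultimately show ?thesis by blast
  qed
qed

lemma zero_lines_le_one_if_strongly_reconstructible:
  assumes "strongly_reconstructible (mat n n f)"
  shows "card (zero_rows n f) \<le> 1" and "card (zero_cols n f) \<le> 1"
proof -
  have d: "distinct (rows (mat n n f))" "distinct (cols (mat n n f))"
    using assms by (auto simp: strongly_reconstructible_iff)
  have "i = k" if "i \<in> zero_rows n f" "k \<in> zero_rows n f" for i k
  proof -
    have "row (mat n n f) i = row (mat n n f) k"
      using that by (auto simp: zero_rows_def)
    then show ?thesis
      using d(1) that nth_eq_iff_index_eq[of "rows (mat n n f)" i k] by (auto simp: zero_rows_def)
  qed
  then show "card (zero_rows n f) \<le> 1"
    by (simp add: card_le_Suc0_iff_eq)
  have "i = k" if "i \<in> zero_cols n f" "k \<in> zero_cols n f" for i k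
  proof -
    have "col (mat n n f) i = col (mat n n f) k"
      using that by (auto simp: zero_cols_def)
    then show ?thesis
      using d(2) that nth_eq_iff_index_eq[of "cols (mat n n f)" i k] by (auto simp: zero_cols_def)
  qed
  then show "card (zero_cols n f) \<le> 1"
    by (simp add: card_le_Suc0_iff_eq)
qed

section \<open>Light lines and the ones moved by an automorphism\<close>

definition row_weight :: "nat \<Rightarrow> (nat \<times> nat \<Rightarrow> bool) \<Rightarrow> nat \<Rightarrow> nat" where
  "row_weight n f i = card {j. j < n \<and> f (i, j)}"

text \<open>Statements on columns are those on rows for the transposed bits.\<close>

abbreviation col_weight :: "nat \<Rightarrow> (nat \<times> nat \<Rightarrow> bool) \<Rightarrow> nat \<Rightarrow> nat" where
  "col_weight n f \<equiv> row_weight n (f \<circ> prod.swap)"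

definition light_rows_meet :: "nat \<Rightarrow> nat \<Rightarrow> (nat \<times> nat \<Rightarrow> bool) \<Rightarrow> bool" where
  "light_rows_meet D n f \<longleftrightarrow> (\<exists>i<n. \<exists>k<n. \<exists>j<n. i \<noteq> k \<and> f (i, j) \<and> f (k, j) \<and>
     row_weight n f i < D \<and> row_weight n f k < D)"

definition light_row_meets_light_col :: "nat \<Rightarrow> nat \<Rightarrow> (nat \<times> nat \<Rightarrow> bool) \<Rightarrow> bool" where
  "light_row_meets_light_col D n f \<longleftrightarrow> (\<exists>i<n. \<exists>j<n. f (i, j) \<and>
     row_weight n f i < D \<and> col_weight n f j < D)"

lemma light_row_meets_light_col_swap:
  "light_row_meets_light_col D n (f \<circ> prod.swap) \<longleftrightarrow> light_row_meets_light_col D n f"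
  by (auto simp: light_row_meets_light_col_def comp_assoc)

lemma matrix_automorphism_swap:
  "matrix_automorphism n f \<pi> \<sigma> \<Longrightarrow> matrix_automorphism n (f \<circ> prod.swap) \<sigma> \<pi>"
  by (auto simp: matrix_automorphism_def)

abbreviation moved :: "nat \<Rightarrow> (nat \<Rightarrow> nat) \<Rightarrow> nat set" where
  "moved n \<pi> \<equiv> {i. i < n \<and> \<pi> i \<noteq> i}"

lemma row_weight_automorphism:
  assumes "matrix_automorphism n f \<pi> \<sigma>" "i < n"
  shows "row_weight n f (\<pi> i) = row_weight n f i"
proof -
  have perm: "\<sigma> permutes {..<n}" and eq: "\<And>j. j < n \<Longrightarrow> f (\<pi> i, \<sigma> j) = f (i, j)"
    using assms by (auto simp: matrix_automorphism_def)
  have "bij_betw \<sigma> {j. j < n \<and> f (i, j)} {j. j < n \<and> f (\<pi> i, j)}"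
  proof (rule bij_betw_imageI)
    show "inj_on \<sigma> {j. j < n \<and> f (i, j)}"
      using permutes_inj[OF perm] by (auto intro: inj_on_subset)
    show "\<sigma> ` {j. j < n \<and> f (i, j)} = {j. j < n \<and> f (\<pi> i, j)}"
    proof (intro subset_antisym subsetI)
      fix y assume y: "y \<in> {j. j < n \<and> f (\<pi> i, j)}"
      then obtain x where "y = \<sigma> x" "x < n"
        using permutes_image[OF perm] by (metis (no_types, lifting) imageE lessThan_iff mem_Collect_eq)
      with y eq show "y \<in> \<sigma> ` {j. j < n \<and> f (i, j)}" by auto
    next
      fix y assume "y \<in> \<sigma> ` {j. j < n \<and> f (i, j)}"
      then show "y \<in> {j. j < n \<and> f (\<pi> i, j)}"
        using eq permutes_in_image[OF perm] by auto
    qed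
  qed
  then show ?thesis
    unfolding row_weight_def using bij_betw_same_card by metis
qed

text \<open>A moved light row contains a one, since otherwise its image would be a second zero row. The column
  of this one is heavy, because light lines do not meet. It is moved, because otherwise the row and
  its image, which has the same weight, would be light rows sharing a column. Distinct light rows
  give distinct columns for the same reason, so the light moved rows inject into the heavy moved
  columns.\<close>

lemma moved_light_rows_le_moved_heavy_cols:
  assumes aut: "matrix_automorphism n f \<pi> \<sigma>"
    and zero: "card (zero_rows n f) \<le> 1"
    and apart: "\<not> light_rows_meet D n f" "\<not> light_row_meets_light_col D n f"
  shows "card {i \<in> moved n \<pi>. row_weight n f i < D} \<le> card {j \<in> moved n \<sigma>. D \<le> col_weight n f j}"
proof -
  have \<pi>: "\<pi> permutes {..<n}" and eq: "\<And>i j. i < n \<Longrightarrow> j < n \<Longrightarrow> f (\<pi> i, \<sigma> j) = f (i, j)"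
    using aut by (auto simp: matrix_automorphism_def)
  have \<pi>n: "\<pi> i < n" if "i < n" for i
    using that permutes_in_image[OF \<pi>] by auto
  have "\<exists>j<n. f (i, j)" if i: "i < n" "\<pi> i \<noteq> i" for i
  proof (rule ccontr)
    assume no: "\<not> (\<exists>j<n. f (i, j))"
    have "row_weight n f i = 0"
      using no by (auto simp: row_weight_def)
    with row_weight_automorphism[OF aut i(1)] have "card {j. j < n \<and> f (\<pi> i, j)} = 0"
      by (metis row_weight_def)
    then have "{j. j < n \<and> f (\<pi> i, j)} = {}"
      by (subst (asm) card_0_eq) auto
    with no i \<pi>n have "{i, \<pi> i} \<subseteq> zero_rows n f"
      by (auto simp: zero_rows_def)
    then have "card {i, \<pi> i} \<le> card (zero_rows n f)"
      by (intro card_mono) auto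
    with zero i(2) show False by auto
  qed
  then obtain w where w: "\<And>i. i < n \<Longrightarrow> \<pi> i \<noteq> i \<Longrightarrow> w i < n \<and> f (i, w i)"
    by metis
  show ?thesis
  proof (rule card_inj_on_le)
    show "inj_on w {i \<in> moved n \<pi>. row_weight n f i < D}"
    proof (rule inj_onI)
      fix i k
      assume ik: "i \<in> {i \<in> moved n \<pi>. row_weight n f i < D}"
        "k \<in> {i \<in> moved n \<pi>. row_weight n f i < D}" "w i = w k"
      show "i = k"
      proof (rule ccontr)
        assume "i \<noteq> k"
        moreover have "f (i, w i)" "f (k, w i)" "w i < n"
          using w[of i] w[of k] ik by auto
        ultimately have "light_rows_meet D n f"
          using ik(1,2) unfolding light_rows_meet_def by blast
        with apart show False by blast
      qed
    qed
    show "w ` {i \<in> moved n \<pi>. row_weight n f i < D} \<subseteq> {j \<in> moved n \<sigma>. D \<le> col_weight n f j}"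
    proof (rule image_subsetI)
      fix i assume "i \<in> {i \<in> moved n \<pi>. row_weight n f i < D}"
      then have i: "i < n" "\<pi> i \<noteq> i" "row_weight n f i < D" by auto
      have wi: "w i < n" "f (i, w i)" using w i by auto
      have "D \<le> col_weight n f (w i)"
      proof (rule ccontr)
        assume "\<not> D \<le> col_weight n f (w i)"
        then have "light_row_meets_light_col D n f"
          unfolding light_row_meets_light_col_def using i wi by (auto simp: not_le)
        with apart show False by blast
      qed
      moreover have "\<sigma> (w i) \<noteq> w i"
      proof
        assume "\<sigma> (w i) = w i"
        then have "f (\<pi> i, w i)"
          using eq[OF i(1) wi(1)] wi by simp
        moreover have "row_weight n f (\<pi> i) < D"
          using row_weight_automorphism[OF aut i(1)] i by simp
        ultimately have "light_rows_meet D n f"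
          unfolding light_rows_meet_def using i wi \<pi>n by metis
        with apart show False by blast
      qed
      ultimately show "w i \<in> {j \<in> moved n \<sigma>. D \<le> col_weight n f j}"
        using wi by auto
    qed
  qed auto
qed

text \<open>These are the cells in a moved row or in a moved column.\<close>

definition moved_cells :: "nat \<Rightarrow> (nat \<Rightarrow> nat) \<Rightarrow> (nat \<Rightarrow> nat) \<Rightarrow> (nat \<times> nat) set" where
  "moved_cells n \<pi> \<sigma> = {x \<in> {..<n} \<times> {..<n}. map_prod \<pi> \<sigma> x \<noteq> x}"

lemma finite_moved_cells [simp, intro]: "finite (moved_cells n \<pi> \<sigma>)"
  by (simp add: moved_cells_def)

lemma moved_cells_swap: "prod.swap ` moved_cells n \<pi> \<sigma> = moved_cells n \<sigma> \<pi>"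
  by (force simp: moved_cells_def image_iff)

lemma heavy_moved_rows_ones:
  "D * card {i \<in> moved n \<pi>. D \<le> row_weight n f i} \<le> card {x \<in> moved_cells n \<pi> \<sigma>. f x}"
proof -
  let ?H = "{i \<in> moved n \<pi>. D \<le> row_weight n f i}"
  have "D * card ?H \<le> (\<Sum>i\<in>?H. row_weight n f i)"
    using sum_bounded_below[of ?H D "row_weight n f"] by (simp add: mult.commute)
  also have "\<dots> = card (SIGMA i:?H. {j. j < n \<and> f (i, j)})"
    by (simp add: row_weight_def)
  also have "\<dots> \<le> card {x \<in> moved_cells n \<pi> \<sigma>. f x}"
    by (rule card_mono) (auto simp: moved_cells_def)
  finally show ?thesis .
qed

lemma heavy_moved_cols_ones:
  "D * card {j \<in> moved n \<sigma>. D \<le> col_weight n f j} \<le> card {x \<in> moved_cells n \<pi> \<sigma>. f x}"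
proof -
  have "D * card {j \<in> moved n \<sigma>. D \<le> col_weight n f j}
      \<le> card {x \<in> moved_cells n \<sigma> \<pi>. (f \<circ> prod.swap) x}"
    by (rule heavy_moved_rows_ones)
  also have "{x \<in> moved_cells n \<sigma> \<pi>. (f \<circ> prod.swap) x} = prod.swap ` {x \<in> moved_cells n \<pi> \<sigma>. f x}"
    by (subst moved_cells_swap[symmetric]) (auto simp: image_iff)
  also have "card \<dots> = card {x \<in> moved_cells n \<pi> \<sigma>. f x}"
    by (intro card_image) simp
  finally show ?thesis .
qed

text \<open>By the injections above at least half of the moved lines are heavy, so at least a quarter of them
  are heavy lines of one and the same side. Lines of one side are disjoint, so their ones add up.\<close>

lemma many_ones_in_moved_cells:
  assumes aut: "matrix_automorphism n f \<pi> \<sigma>"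
    and zero: "card (zero_rows n f) \<le> 1" "card (zero_cols n f) \<le> 1"
    and apart: "\<not> light_rows_meet D n f" "\<not> light_rows_meet D n (f \<circ> prod.swap)"
      "\<not> light_row_meets_light_col D n f"
  shows "D * (card (moved n \<pi>) + card (moved n \<sigma>)) \<le> 4 * card {x \<in> moved_cells n \<pi> \<sigma>. f x}"
proof -
  define LR HR where "LR = card {i \<in> moved n \<pi>. row_weight n f i < D}"
    and "HR = card {i \<in> moved n \<pi>. D \<le> row_weight n f i}"
  define LC HC where "LC = card {j \<in> moved n \<sigma>. col_weight n f j < D}"
    and "HC = card {j \<in> moved n \<sigma>. D \<le> col_weight n f j}"
  define k where "k = card {x \<in> moved_cells n \<pi> \<sigma>. f x}"
  have "LR \<le> HC"
    unfolding LR_def HC_def using moved_light_rows_le_moved_heavy_cols aut zero apart by blast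
  moreover have "LC \<le> HR"
    using moved_light_rows_le_moved_heavy_cols[OF matrix_automorphism_swap[OF aut], of D] zero apart
    by (simp add: LC_def HR_def zero_cols_swap light_row_meets_light_col_swap comp_assoc)
  moreover have "card (moved n \<pi>) = LR + HR"
    unfolding LR_def HR_def by (subst card_Un_disjoint[symmetric]) (auto intro!: arg_cong[where f = card])
  moreover have "card (moved n \<sigma>) = LC + HC"
    unfolding LC_def HC_def by (subst card_Un_disjoint[symmetric]) (auto intro!: arg_cong[where f = card])
  ultimately have "D * (card (moved n \<pi>) + card (moved n \<sigma>)) \<le> D * (2 * HR + 2 * HC)"
    by (intro mult_left_mono) auto
  also have "\<dots> = 2 * (D * HR) + 2 * (D * HC)"
    by (simp add: algebra_simps)
  also have "\<dots> \<le> 4 * k"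
    using heavy_moved_rows_ones[of D n \<pi> f \<sigma>] heavy_moved_cols_ones[of D n \<sigma> f \<pi>]
    unfolding HR_def HC_def k_def by linarith
  finally show ?thesis by (simp add: k_def)
qed

section \<open>Independent bits\<close>

abbreviation random_bits :: "'a set \<Rightarrow> real \<Rightarrow> ('a \<Rightarrow> bool) pmf" where
  "random_bits A p \<equiv> Pi_pmf A False (\<lambda>_. bernoulli_pmf p)"

lemma integrable_indicator_pmf [simp]: "integrable (measure_pmf M) (indicat_real S)"
  by (intro measure_pmf.integrable_const_bound[where B = 1]) auto

lemma prob_eq_expectation_of_bool:
  "measure_pmf.prob M {x. Q x} = measure_pmf.expectation M (\<lambda>x. of_bool (Q x))"
proof -
  have "(\<lambda>x. of_bool (Q x)) = indicat_real {x. Q x}"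
    by (auto simp: indicator_def fun_eq_iff)
  then show ?thesis by simp
qed

lemma prob_UN_le:
  assumes "finite I" "S \<subseteq> (\<Union>x\<in>I. E x)" "\<And>x. x \<in> I \<Longrightarrow> measure_pmf.prob M (E x) \<le> b"
  shows "measure_pmf.prob M S \<le> real (card I) * b"
proof -
  have "measure_pmf.prob M S \<le> measure_pmf.prob M (\<Union>x\<in>I. E x)"
    using assms by (intro measure_pmf.finite_measure_mono) auto
  also have "\<dots> \<le> (\<Sum>x\<in>I. measure_pmf.prob M (E x))"
    using assms by (intro measure_pmf.finite_measure_subadditive_finite) auto
  also have "\<dots> \<le> real (card I) * b"
    using assms by (intro sum_bounded_above) auto
  finally show ?thesis .
qed

lemma prob_bernoulli:
  assumes "0 \<le> p" "p \<le> 1"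
  shows "measure_pmf.prob (bernoulli_pmf p) {True} = p"
    and "measure_pmf.prob (bernoulli_pmf p) {False} = 1 - p"
  using assms by (simp_all add: measure_pmf_single)

lemma prob_bits_prescribed:
  assumes "finite A" "0 \<le> p" "p \<le> 1" "S \<subseteq> A" "T \<subseteq> A" "S \<inter> T = {}"
  shows "measure_pmf.prob (random_bits A p) {f. (\<forall>x\<in>S. f x) \<and> (\<forall>x\<in>T. \<not> f x)} = p ^ card S * (1 - p) ^ card T"
proof -
  define B where "B = (\<lambda>x. if x \<in> S then {True} else if x \<in> T then {False} else UNIV)"
  have fin: "finite S" "finite T"
    using assms finite_subset by blast+
  have "{f. (\<forall>x\<in>S. f x) \<and> (\<forall>x\<in>T. \<not> f x)} = Pi A B"
    using assms(4-6) by (auto simp: B_def Pi_def split: if_splits)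
  then have "measure_pmf.prob (random_bits A p) {f. (\<forall>x\<in>S. f x) \<and> (\<forall>x\<in>T. \<not> f x)} =
      (\<Prod>x\<in>A. measure_pmf.prob (bernoulli_pmf p) (B x))"
    using assms(1) by (simp add: measure_Pi_pmf_Pi)
  also have "\<dots> = (\<Prod>x\<in>S \<union> T. measure_pmf.prob (bernoulli_pmf p) (B x))"
    using assms by (intro prod.mono_neutral_right) (auto simp: B_def)
  also have "\<dots> = (\<Prod>x\<in>S. measure_pmf.prob (bernoulli_pmf p) (B x)) *
      (\<Prod>x\<in>T. measure_pmf.prob (bernoulli_pmf p) (B x))"
    using fin assms by (intro prod.union_disjoint)
  also have "(\<Prod>x\<in>S. measure_pmf.prob (bernoulli_pmf p) (B x)) = (\<Prod>x\<in>S. p)"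
    using assms by (intro prod.cong) (auto simp: B_def prob_bernoulli)
  also have "(\<Prod>x\<in>T. measure_pmf.prob (bernoulli_pmf p) (B x)) = (\<Prod>x\<in>T. 1 - p)"
    using assms by (intro prod.cong) (auto simp: B_def prob_bernoulli)
  finally show ?thesis by simp
qed

text \<open>Exponential Markov inequality: every one in \<open>Z\<close> is weighted by \<open>t\<close>, and the expectation of a
  product of functions of single bits factorises.\<close>

lemma prob_ones_and_few_ones_le:
  assumes A: "finite A" and p: "0 \<le> p" "p \<le> 1" and t: "0 < t" "t \<le> 1"
    and W: "W \<subseteq> A" and Z: "Z \<subseteq> A" and WZ: "W \<inter> Z = {}"
  shows "measure_pmf.prob (random_bits A p) {f. (\<forall>x\<in>W. f x) \<and> card {x\<in>Z. f x} \<le> m}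
    \<le> p ^ card W * (1 - p * (1 - t)) ^ card Z / t ^ m"
proof -
  define w :: "'a \<Rightarrow> bool \<Rightarrow> real" where
    "w = (\<lambda>x b. if x \<in> W then of_bool b else if x \<in> Z then (if b then t else 1) else 1)"
  have fin: "finite W" "finite Z"
    using A W Z finite_subset by blast+
  let ?E = "{f. (\<forall>x\<in>W. f x) \<and> card {x\<in>Z. f x} \<le> m}"
  have nn: "0 \<le> w x b" for x b using t by (auto simp: w_def)
  have ind: "indicator ?E f \<le> (\<Prod>x\<in>A. w x (f x)) / t ^ m" for f
  proof (cases "f \<in> ?E")
    case True
    have "(\<Prod>x\<in>A. w x (f x)) = (\<Prod>x\<in>{x\<in>Z. f x}. w x (f x))"
      using A Z WZ True by (intro prod.mono_neutral_right) (auto simp: w_def)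
    also have "\<dots> = (\<Prod>x\<in>{x\<in>Z. f x}. t)"
      using WZ by (intro prod.cong) (auto simp: w_def)
    also have "\<dots> \<ge> t ^ m"
      using True t by (auto intro!: power_decreasing)
    finally show ?thesis using True t by simp
  next
    case False
    then show ?thesis using nn t by (auto intro!: divide_nonneg_nonneg prod_nonneg)
  qed
  have int: "integrable (measure_pmf (random_bits A p)) (\<lambda>f. (\<Prod>x\<in>A. w x (f x)))"
    using A by (intro integrable_prod_Pi_pmf) (auto intro: integrable_measure_pmf_finite)
  have "measure_pmf.prob (random_bits A p) ?E = measure_pmf.expectation (random_bits A p) (indicator ?E)"
    by simp
  also have "\<dots> \<le> measure_pmf.expectation (random_bits A p) (\<lambda>f. (\<Prod>x\<in>A. w x (f x)) / t ^ m)"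
    using int by (intro integral_mono ind integrable_indicator_pmf) auto
  also have "\<dots> = measure_pmf.expectation (random_bits A p) (\<lambda>f. (\<Prod>x\<in>A. w x (f x))) / t ^ m"
    using int by simp
  also have "measure_pmf.expectation (random_bits A p) (\<lambda>f. (\<Prod>x\<in>A. w x (f x)))
      = (\<Prod>x\<in>A. measure_pmf.expectation (bernoulli_pmf p) (w x))"
    using A nn by (intro expectation_prod_Pi_pmf) (auto intro: integrable_measure_pmf_finite)
  also have "\<dots> = (\<Prod>x\<in>A. p * w x True + (1 - p) * w x False)"
    using p by (simp add: mult.commute)
  also have "\<dots> = (\<Prod>x\<in>W \<union> Z. p * w x True + (1 - p) * w x False)"
    using A W Z by (intro prod.mono_neutral_right) (auto simp: w_def)
  also have "\<dots> = (\<Prod>x\<in>W. p * w x True + (1 - p) * w x False) * (\<Prod>x\<in>Z. p * w x True + (1 - p) * w x False)"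
    using fin WZ by (intro prod.union_disjoint)
  also have "(\<Prod>x\<in>W. p * w x True + (1 - p) * w x False) = (\<Prod>x\<in>W. p)"
    by (intro prod.cong) (auto simp: w_def)
  also have "(\<Prod>x\<in>Z. p * w x True + (1 - p) * w x False) = (\<Prod>x\<in>Z. 1 - p * (1 - t))"
    using WZ by (intro prod.cong) (auto simp: w_def algebra_simps)
  finally show ?thesis by simp
qed

section \<open>The probability of a given automorphism\<close>

text \<open>The graph that joins \<open>x\<close> to \<open>g x\<close> has maximal degree 2 for injective \<open>g\<close>, so a greedy colouring
  uses three colours.\<close>

lemma three_colouring:
  assumes "finite X" "inj_on g X" "\<And>x. x \<in> X \<Longrightarrow> g x \<noteq> x"
  shows "\<exists>c :: 'a \<Rightarrow> nat. \<forall>x\<in>X. c x < 3 \<and> (g x \<in> X \<longrightarrow> c (g x) \<noteq> c x)"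
  using assms
proof (induction X rule: finite_induct)
  case (insert x X)
  then obtain c :: "'a \<Rightarrow> nat" where c: "\<And>y. y \<in> X \<Longrightarrow> c y < 3 \<and> (g y \<in> X \<longrightarrow> c (g y) \<noteq> c y)"
    by (auto simp: inj_on_insert)
  define y where "y = (SOME y. y \<in> X \<and> g y = x)"
  have y: "z = y" if "z \<in> X" "g z = x" for z
  proof -
    have "y \<in> X \<and> g y = x" unfolding y_def by (rule someI[of _ z]) (use that in auto)
    with that insert.prems(1) show ?thesis by (auto simp: inj_on_def)
  qed
  have "\<exists>k<3. k \<noteq> c y \<and> k \<noteq> c (g x)"
  proof -
    have "card {c y, c (g x)} < card {..<3::nat}"
      by (rule le_less_trans[OF card_insert_le_m1]) auto
    then obtain k where "k \<in> {..<3} - {c y, c (g x)}"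
      by (metis (no_types, lifting) DiffI card_mono finite.emptyI finite.insertI not_le subsetI)
    then show ?thesis by auto
  qed
  then obtain k where k: "k < 3" "k \<noteq> c y" "k \<noteq> c (g x)" by blast
  have "(c(x := k)) z < 3 \<and> (g z \<in> insert x X \<longrightarrow> (c(x := k)) (g z) \<noteq> (c(x := k)) z)"
    if "z \<in> insert x X" for z
    using that insert c k y by auto
  then show ?case by blast
qed auto

text \<open>The bits on \<open>g ` U\<close> are independent of those on \<open>U\<close>. Once the latter are known, each of their ones
  has to be repeated at its image, which has probability \<open>p\<close>.\<close>

lemma prob_copied_ones_le:
  assumes A: "finite A" and p: "0 \<le> p" "p \<le> 1" and U: "U \<subseteq> A" "g ` U \<subseteq> A" "inj_on g U" "U \<inter> g ` U = {}"
  shows "measure_pmf.prob (random_bits A p) {f. (\<forall>x\<in>U. f (g x) = f x) \<and> s \<le> card {x\<in>U. f x}} \<le> p ^ s"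
proof -
  let ?P = "measure_pmf.prob (random_bits A p)"
  let ?E = "\<lambda>S. {f. (\<forall>x\<in>S. f x) \<and> (\<forall>x\<in>U - S. \<not> f x)}"
  let ?F = "\<lambda>S. {f. (\<forall>x\<in>S \<union> g ` S. f x) \<and> (\<forall>x\<in>U - S. \<not> f x)}"
  have fin: "finite U" using A U finite_subset by auto
  have "?P {f. (\<forall>x\<in>U. f (g x) = f x) \<and> s \<le> card {x\<in>U. f x}} \<le> ?P (\<Union>S\<in>{S\<in>Pow U. s \<le> card S}. ?F S)"
  proof (rule measure_pmf.finite_measure_mono)
    show "{f. (\<forall>x\<in>U. f (g x) = f x) \<and> s \<le> card {x\<in>U. f x}} \<subseteq> (\<Union>S\<in>{S\<in>Pow U. s \<le> card S}. ?F S)"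
    proof
      fix f assume "f \<in> {f. (\<forall>x\<in>U. f (g x) = f x) \<and> s \<le> card {x\<in>U. f x}}"
      then show "f \<in> (\<Union>S\<in>{S\<in>Pow U. s \<le> card S}. ?F S)"
        by (intro UN_I[of "{x\<in>U. f x}"]) auto
    qed
  qed auto
  also have "\<dots> \<le> (\<Sum>S\<in>{S\<in>Pow U. s \<le> card S}. ?P (?F S))"
    using fin by (intro measure_pmf.finite_measure_subadditive_finite) auto
  also have "\<dots> \<le> (\<Sum>S\<in>{S\<in>Pow U. s \<le> card S}. p ^ s * ?P (?E S))"
  proof (rule sum_mono)
    fix S assume S: "S \<in> {S\<in>Pow U. s \<le> card S}"
    then have SU: "S \<subseteq> U" "finite S" using fin finite_subset by auto
    have "?P (?F S) = p ^ card (S \<union> g ` S) * (1 - p) ^ card (U - S)"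
    proof (rule prob_bits_prescribed[OF A p])
      show "S \<union> g ` S \<subseteq> A" "U - S \<subseteq> A" using U SU by blast+
      show "(S \<union> g ` S) \<inter> (U - S) = {}" using U(4) SU by blast
    qed
    also have "card (S \<union> g ` S) = card S + card (g ` S)"
      using SU U(4) by (intro card_Un_disjoint) blast+
    also have "card (g ` S) = card S"
      using SU U by (intro card_image) (auto intro: inj_on_subset)
    also have "p ^ (card S + card S) * (1 - p) ^ card (U - S) = p ^ card S * ?P (?E S)"
      using A p U SU by (subst prob_bits_prescribed) (auto simp: power_add)
    also have "\<dots> \<le> p ^ s * ?P (?E S)"
      using p S by (intro mult_right_mono power_decreasing) auto
    finally show "?P (?F S) \<le> p ^ s * ?P (?E S)" .
  qed
  also have "\<dots> = p ^ s * (\<Sum>S\<in>{S\<in>Pow U. s \<le> card S}. ?P (?E S))"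
    by (simp add: sum_distrib_left)
  also have "(\<Sum>S\<in>{S\<in>Pow U. s \<le> card S}. ?P (?E S)) = ?P (\<Union>S\<in>{S\<in>Pow U. s \<le> card S}. ?E S)"
  proof (rule measure_pmf.finite_measure_finite_Union[symmetric])
    show "disjoint_family_on ?E {S\<in>Pow U. s \<le> card S}"
      by (auto simp: disjoint_family_on_def)
  qed (use fin in auto)
  also have "p ^ s * \<dots> \<le> p ^ s * 1"
    using p by (intro mult_left_mono) auto
  finally show ?thesis by simp
qed

text \<open>The set \<open>X\<close> may meet its image, so it is split into three colour classes disjoint from their
  images. One of them carries a third of the ones.\<close>

lemma prob_invariant_ones_le:
  assumes A: "finite A" and p: "0 \<le> p" "p \<le> 1"
    and X: "X \<subseteq> A" "g ` X \<subseteq> A" "inj_on g X" "\<And>x. x \<in> X \<Longrightarrow> g x \<noteq> x"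
  shows "measure_pmf.prob (random_bits A p) {f. (\<forall>x\<in>X. f (g x) = f x) \<and> 3 * s \<le> card {x\<in>X. f x}} \<le> 3 * p ^ s"
proof (cases "s = 0")
  case True
  then show ?thesis by (auto intro: order.trans[OF measure_pmf.prob_le_1])
next
  case False
  let ?P = "measure_pmf.prob (random_bits A p)"
  have fin: "finite X" using A X finite_subset by auto
  obtain c :: "'a \<Rightarrow> nat" where c: "\<And>x. x \<in> X \<Longrightarrow> c x < 3" "\<And>x. x \<in> X \<Longrightarrow> g x \<in> X \<Longrightarrow> c (g x) \<noteq> c x"
    using three_colouring[OF fin X(3,4)] by blast
  define U where "U = (\<lambda>k. {x\<in>X. c x = k})"
  let ?E = "\<lambda>k. {f. (\<forall>x\<in>U k. f (g x) = f x) \<and> s \<le> card {x\<in>U k. f x}}"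
  have "{f. (\<forall>x\<in>X. f (g x) = f x) \<and> 3 * s \<le> card {x\<in>X. f x}} \<subseteq> (\<Union>k<3. ?E k)"
  proof
    fix f assume f: "f \<in> {f. (\<forall>x\<in>X. f (g x) = f x) \<and> 3 * s \<le> card {x\<in>X. f x}}"
    have "{x\<in>X. f x} = (\<Union>k<3. {x\<in>U k. f x})"
      using c(1) by (auto simp: U_def)
    then have "card {x\<in>X. f x} \<le> (\<Sum>k<3. card {x\<in>U k. f x})"
      using card_UN_le[of "{..<3::nat}" "\<lambda>k. {x\<in>U k. f x}"] by simp
    with f have "3 * s \<le> (\<Sum>k<3. card {x\<in>U k. f x})" by simp
    then have "\<exists>k<3. s \<le> card {x\<in>U k. f x}"
      using sum_strict_mono[of "{..<3::nat}" "\<lambda>k. card {x\<in>U k. f x}" "\<lambda>_. s"] by force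
    with f show "f \<in> (\<Union>k<3. ?E k)"
      by (auto simp: U_def)
  qed
  then have "?P {f. (\<forall>x\<in>X. f (g x) = f x) \<and> 3 * s \<le> card {x\<in>X. f x}} \<le> ?P (\<Union>k<3. ?E k)"
    by (intro measure_pmf.finite_measure_mono) auto
  also have "\<dots> \<le> (\<Sum>k<3. ?P (?E k))"
    by (intro measure_pmf.finite_measure_subadditive_finite) auto
  also have "\<dots> \<le> (\<Sum>k<3::nat. p ^ s)"
  proof (intro sum_mono prob_copied_ones_le A p)
    fix k
    show "U k \<inter> g ` U k = {}" using c(2) unfolding U_def by force
    show "inj_on g (U k)" using X(3) by (rule inj_on_subset) (auto simp: U_def)
  qed (use X in \<open>auto simp: U_def\<close>)
  finally show ?thesis by simp
qed

section \<open>Summing over all pairs of permutations\<close>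

lemma sum_Pow_power_card:
  fixes z :: "'b::comm_ring_1"
  assumes "finite A"
  shows "(\<Sum>R\<in>Pow A. z ^ card R) = (1 + z) ^ card A"
proof -
  have "(1 + z) ^ card A = (\<Prod>x\<in>A. z + 1)" by (simp add: add.commute)
  also have "\<dots> = (\<Sum>R\<in>Pow A. (\<Prod>x\<in>R. z) * (\<Prod>x\<in>A - R. 1))"
    using assms by (rule prod_add)
  finally show ?thesis by simp
qed

text \<open>A permutation is determined by the part of its graph off the diagonal, so the sum is dominated by
  the sum over all subsets of the grid.\<close>

lemma sum_permutations_power_moved_le:
  fixes z :: real
  assumes "0 \<le> z"
  shows "(\<Sum>\<pi> | \<pi> permutes {..<n}. z ^ card (moved n \<pi>)) \<le> (1 + z) ^ (n * n)"
proof -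
  define G where "G = (\<lambda>\<pi>. (\<lambda>i. (i, \<pi> i)) ` moved n \<pi>)"
  have inj: "inj_on G {\<pi>. \<pi> permutes {..<n}}"
  proof (rule inj_onI)
    fix \<pi> \<rho> assume "\<pi> \<in> {\<pi>. \<pi> permutes {..<n}}" "\<rho> \<in> {\<pi>. \<pi> permutes {..<n}}" and G: "G \<pi> = G \<rho>"
    then have perm: "\<pi> permutes {..<n}" "\<rho> permutes {..<n}" by auto
    have mem: "(i, k) \<in> G \<tau> \<longleftrightarrow> i < n \<and> \<tau> i = k \<and> k \<noteq> i" for i k \<tau> by (auto simp: G_def)
    show "\<pi> = \<rho>"
    proof
      fix i
      show "\<pi> i = \<rho> i"
        using mem[of i "\<pi> i" \<pi>] mem[of i "\<pi> i" \<rho>] mem[of i "\<rho> i" \<pi>] mem[of i "\<rho> i" \<rho>] G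
          permutes_not_in[OF perm(1), of i] permutes_not_in[OF perm(2), of i] by (metis lessThan_iff)
    qed
  qed
  have "(\<Sum>\<pi> | \<pi> permutes {..<n}. z ^ card (moved n \<pi>)) = (\<Sum>\<pi> | \<pi> permutes {..<n}. z ^ card (G \<pi>))"
    by (intro sum.cong refl) (simp add: G_def card_image inj_on_def)
  also have "\<dots> = (\<Sum>R\<in>G ` {\<pi>. \<pi> permutes {..<n}}. z ^ card R)"
    using inj by (simp add: sum.reindex)
  also have "\<dots> \<le> (\<Sum>R\<in>Pow ({..<n} \<times> {..<n}). z ^ card R)"
  proof (rule sum_mono2)
    show "G ` {\<pi>. \<pi> permutes {..<n}} \<subseteq> Pow ({..<n} \<times> {..<n})"
      by (auto simp: G_def dest: permutes_in_image)
  qed (use assms in auto)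
  also have "\<dots> = (1 + z) ^ (n * n)"
    by (subst sum_Pow_power_card) (auto simp: card_cartesian_product)
  finally show ?thesis .
qed

lemma sum_nontrivial_pairs_le:
  fixes z :: real
  assumes "0 \<le> z"
  shows "(\<Sum>(\<pi>, \<sigma>)\<in>{\<pi>. \<pi> permutes {..<n}} \<times> {\<sigma>. \<sigma> permutes {..<n}} - {(id, id)}.
      z ^ (card (moved n \<pi>) + card (moved n \<sigma>))) \<le> (1 + z) ^ (2 * (n * n)) - 1"
proof -
  let ?S = "{\<pi>. \<pi> permutes {..<n}}"
  have fin: "finite (?S \<times> ?S)" by (simp add: finite_permutations)
  have "(\<Sum>(\<pi>, \<sigma>)\<in>?S \<times> ?S. z ^ (card (moved n \<pi>) + card (moved n \<sigma>)))
      = (\<Sum>\<pi>\<in>?S. z ^ card (moved n \<pi>)) * (\<Sum>\<pi>\<in>?S. z ^ card (moved n \<pi>))"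
    by (simp add: sum_product sum.cartesian_product power_add)
  also have "\<dots> \<le> (1 + z) ^ (n * n) * (1 + z) ^ (n * n)"
    using assms by (intro mult_mono sum_permutations_power_moved_le sum_nonneg) auto
  finally have "(\<Sum>(\<pi>, \<sigma>)\<in>?S \<times> ?S. z ^ (card (moved n \<pi>) + card (moved n \<sigma>))) \<le> (1 + z) ^ (2 * (n * n))"
    by (simp add: mult_2 power_add)
  then show ?thesis
    using fin by (subst sum_diff1) (auto simp: permutes_id)
qed

section \<open>Random matrices without nontrivial automorphisms\<close>

abbreviation random_grid :: "nat \<Rightarrow> real \<Rightarrow> (nat \<times> nat \<Rightarrow> bool) pmf" where
  "random_grid n p \<equiv> random_bits ({..<n} \<times> {..<n}) p"

lemma prob_random_grid_swap:
  "measure_pmf.prob (random_grid n p) {f. Q (f \<circ> prod.swap)} = measure_pmf.prob (random_grid n p) {f. Q f}"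
proof -
  have "random_grid n p = map_pmf (\<lambda>f. f \<circ> prod.swap) (random_grid n p)"
    by (rule Pi_pmf_bij_betw) (auto intro!: bij_betwI[where g = prod.swap])
  then have "measure_pmf.prob (random_grid n p) {f. Q f} =
      measure_pmf.prob (map_pmf (\<lambda>f. f \<circ> prod.swap) (random_grid n p)) {f. Q f}"
    by simp
  also have "\<dots> = measure_pmf.prob (random_grid n p) {f. Q (f \<circ> prod.swap)}"
    by (simp add: vimage_def)
  finally show ?thesis by simp
qed

text \<open>Two rows \<open>i\<close>, \<open>k\<close> and a common column \<open>j\<close> can be chosen in at most \<open>n ^ 3\<close> ways. The two cells in
  column \<open>j\<close> are ones, and the other \<open>2 * (n - 1)\<close> cells of the two rows contain fewer than \<open>2 * D\<close>
  ones.\<close>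

lemma prob_light_rows_meet_le:
  assumes p: "0 \<le> p" "p \<le> 1" and t: "0 < t" "t \<le> 1"
  shows "measure_pmf.prob (random_grid n p) {f. light_rows_meet D n f}
    \<le> real n ^ 3 * (p ^ 2 * ((1 - p * (1 - t)) ^ (2 * (n - 1)) / t ^ (2 * D)))"
proof -
  define I where "I = {(i, k, j). i < n \<and> k < n \<and> j < n \<and> i \<noteq> k}"
  define W :: "nat \<times> nat \<times> nat \<Rightarrow> (nat \<times> nat) set" where "W = (\<lambda>(i, k, j). {(i, j), (k, j)})"
  define Z :: "nat \<times> nat \<times> nat \<Rightarrow> (nat \<times> nat) set" where "Z = (\<lambda>(i, k, j). {i, k} \<times> ({..<n} - {j}))"
  have IS: "I \<subseteq> {..<n} \<times> {..<n} \<times> {..<n}" by (auto simp: I_def)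
  then have fin: "finite I" by (rule finite_subset) auto
  have "card I \<le> card ({..<n} \<times> {..<n} \<times> {..<n})"
    using IS by (rule card_mono[rotated]) auto
  then have cI: "card I \<le> n ^ 3"
    by (simp add: card_cartesian_product power3_eq_cube mult.assoc)
  have "measure_pmf.prob (random_grid n p) {f. light_rows_meet D n f}
    \<le> real (card I) * (p ^ 2 * (1 - p * (1 - t)) ^ (2 * (n - 1)) / t ^ (2 * D))"
  proof (rule prob_UN_le[OF fin])
    show "{f. light_rows_meet D n f} \<subseteq> (\<Union>x\<in>I. {f. (\<forall>y\<in>W x. f y) \<and> card {y\<in>Z x. f y} \<le> 2 * D})"
    proof
      fix f assume "f \<in> {f. light_rows_meet D n f}"
      then obtain i k j where x: "i < n" "k < n" "j < n" "i \<noteq> k" "f (i, j)" "f (k, j)"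
        "row_weight n f i < D" "row_weight n f k < D"
        by (auto simp: light_rows_meet_def)
      have "card {y\<in>Z (i, k, j). f y} \<le> card (Pair i ` {j. j < n \<and> f (i, j)} \<union> Pair k ` {j. j < n \<and> f (k, j)})"
        by (intro card_mono) (auto simp: Z_def)
      also have "\<dots> \<le> card (Pair i ` {j. j < n \<and> f (i, j)}) + card (Pair k ` {j. j < n \<and> f (k, j)})"
        by (rule card_Un_le)
      also have "\<dots> = row_weight n f i + row_weight n f k"
        by (simp add: row_weight_def card_image inj_on_def)
      finally have "card {y\<in>Z (i, k, j). f y} \<le> 2 * D" using x by simp
      then show "f \<in> (\<Union>x\<in>I. {f. (\<forall>y\<in>W x. f y) \<and> card {y\<in>Z x. f y} \<le> 2 * D})"
        using x by (intro UN_I[of "(i, k, j)"]) (auto simp: I_def W_def)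
    qed
  next
    fix x assume "x \<in> I"
    then obtain i k j where x: "x = (i, k, j)" "i < n" "k < n" "j < n" "i \<noteq> k"
      by (auto simp: I_def)
    have "card (W x) = 2" using x by (simp add: W_def)
    moreover have "card (Z x) = 2 * (n - 1)" using x by (simp add: Z_def card_cartesian_product)
    moreover have "measure_pmf.prob (random_grid n p) {f. (\<forall>y\<in>W x. f y) \<and> card {y\<in>Z x. f y} \<le> 2 * D}
        \<le> p ^ card (W x) * (1 - p * (1 - t)) ^ card (Z x) / t ^ (2 * D)"
      using x by (intro prob_ones_and_few_ones_le p t) (auto simp: W_def Z_def)
    ultimately show "measure_pmf.prob (random_grid n p) {f. (\<forall>y\<in>W x. f y) \<and> card {y\<in>Z x. f y} \<le> 2 * D}
        \<le> p ^ 2 * (1 - p * (1 - t)) ^ (2 * (n - 1)) / t ^ (2 * D)" by simp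
  qed
  also have "\<dots> \<le> real (n ^ 3) * (p ^ 2 * (1 - p * (1 - t)) ^ (2 * (n - 1)) / t ^ (2 * D))"
    using cI p t by (intro mult_right_mono divide_nonneg_nonneg mult_nonneg_nonneg)
      (auto intro: mult_le_one simp del: of_nat_power)
  finally show ?thesis by simp
qed

text \<open>The same estimate for a row and a column, which share the single cell prescribed to be one.\<close>

lemma prob_light_row_meets_light_col_le:
  assumes p: "0 \<le> p" "p \<le> 1" and t: "0 < t" "t \<le> 1"
  shows "measure_pmf.prob (random_grid n p) {f. light_row_meets_light_col D n f}
    \<le> real n ^ 2 * (p * ((1 - p * (1 - t)) ^ (2 * (n - 1)) / t ^ (2 * D)))"
proof -
  define I where "I = {..<n} \<times> {..<n}"
  define Z where "Z = (\<lambda>(i, j). Pair i ` ({..<n} - {j}) \<union> (\<lambda>k. (k, j)) ` ({..<n} - {i}))"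
  have "measure_pmf.prob (random_grid n p) {f. light_row_meets_light_col D n f}
    \<le> real (card I) * (p * (1 - p * (1 - t)) ^ (2 * (n - 1)) / t ^ (2 * D))"
  proof (rule prob_UN_le)
    show "finite I" by (simp add: I_def)
    show "{f. light_row_meets_light_col D n f} \<subseteq> (\<Union>x\<in>I. {f. (\<forall>y\<in>{x}. f y) \<and> card {y\<in>Z x. f y} \<le> 2 * D})"
    proof
      fix f assume "f \<in> {f. light_row_meets_light_col D n f}"
      then obtain i j where x: "i < n" "j < n" "f (i, j)"
        "row_weight n f i < D" "col_weight n f j < D"
        by (auto simp: light_row_meets_light_col_def)
      have "card {y\<in>Z (i, j). f y} \<le> card (Pair i ` {j. j < n \<and> f (i, j)} \<union> (\<lambda>k. (k, j)) ` {k. k < n \<and> f (k, j)})"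
        by (intro card_mono) (auto simp: Z_def)
      also have "\<dots> \<le> card (Pair i ` {j. j < n \<and> f (i, j)}) + card ((\<lambda>k. (k, j)) ` {k. k < n \<and> f (k, j)})"
        by (rule card_Un_le)
      also have "\<dots> = row_weight n f i + col_weight n f j"
        by (simp add: row_weight_def card_image inj_on_def)
      finally have "card {y\<in>Z (i, j). f y} \<le> 2 * D" using x by simp
      then show "f \<in> (\<Union>x\<in>I. {f. (\<forall>y\<in>{x}. f y) \<and> card {y\<in>Z x. f y} \<le> 2 * D})"
        using x by (intro UN_I[of "(i, j)"]) (auto simp: I_def)
    qed
  next
    fix x assume "x \<in> I"
    then obtain i j where x: "x = (i, j)" "i < n" "j < n"
      by (auto simp: I_def)
    have "card (Z x) = card (Pair i ` ({..<n} - {j})) + card ((\<lambda>k. (k, j)) ` ({..<n} - {i}))"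
      unfolding Z_def x by (simp, intro card_Un_disjoint) auto
    then have "card (Z x) = 2 * (n - 1)" using x by (simp add: card_image inj_on_def)
    moreover have "measure_pmf.prob (random_grid n p) {f. (\<forall>y\<in>{x}. f y) \<and> card {y\<in>Z x. f y} \<le> 2 * D}
        \<le> p ^ card {x} * (1 - p * (1 - t)) ^ card (Z x) / t ^ (2 * D)"
      using x by (intro prob_ones_and_few_ones_le p t) (auto simp: Z_def)
    ultimately show "measure_pmf.prob (random_grid n p) {f. (\<forall>y\<in>{x}. f y) \<and> card {y\<in>Z x. f y} \<le> 2 * D}
        \<le> p * (1 - p * (1 - t)) ^ (2 * (n - 1)) / t ^ (2 * D)" by simp
  qed
  also have "card I = n ^ 2" by (simp add: I_def card_cartesian_product power2_eq_square)
  finally show ?thesis by simp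
qed

text \<open>Lines are called light if they have fewer than \<open>12 * d\<close> ones. The first summand bounds the
  probability that light lines meet. Otherwise every automorphism that moves \<open>m\<close> lines has at least
  \<open>3 * d * m\<close> ones in moved cells, which for a given pair of permutations has probability at most
  \<open>3 * (p ^ d) ^ m\<close>; the second summand is the union bound over the nontrivial pairs.\<close>

lemma prob_not_reconstructible_few_zero_lines_le:
  assumes p: "0 \<le> p" "p \<le> 1" and t: "0 < t" "t \<le> 1"
  shows "measure_pmf.prob (random_grid n p) {f. few_zero_lines n f \<and> \<not> strongly_reconstructible (mat n n f)}
    \<le> (2 * real n ^ 3 * p ^ 2 + real n ^ 2 * p) * ((1 - p * (1 - t)) ^ (2 * (n - 1)) / t ^ (24 * d))
      + 3 * ((1 + p ^ d) ^ (2 * (n * n)) - 1)" (is "_ \<le> ?rhs")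
proof -
  let ?P = "measure_pmf.prob (random_grid n p)"
  let ?S = "{\<pi>. \<pi> permutes {..<n}} \<times> {\<sigma>. \<sigma> permutes {..<n}} - {(id, id)}"
  define m where "m = (\<lambda>(\<pi>, \<sigma>). card (moved n \<pi>) + card (moved n \<sigma>))"
  define X where "X = (\<lambda>(\<pi>, \<sigma>). moved_cells n \<pi> \<sigma>)"
  define g :: "(nat \<Rightarrow> nat) \<times> (nat \<Rightarrow> nat) \<Rightarrow> nat \<times> nat \<Rightarrow> nat \<times> nat" where
    "g = (\<lambda>(\<pi>, \<sigma>). map_prod \<pi> \<sigma>)"
  define E where "E = (\<lambda>x. {f. (\<forall>y\<in>X x. f (g x y) = f y) \<and> 3 * (d * m x) \<le> card {y\<in>X x. f y}})"
  let ?A = "{f. light_rows_meet (12 * d) n f}"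
  let ?B = "{f. light_rows_meet (12 * d) n (f \<circ> prod.swap)}"
  let ?C = "{f. light_row_meets_light_col (12 * d) n f}"
  have finS: "finite ?S" by (simp add: finite_permutations)
  have "{f. few_zero_lines n f \<and> \<not> strongly_reconstructible (mat n n f)} \<subseteq> ?A \<union> ?B \<union> ?C \<union> (\<Union>x\<in>?S. E x)"
  proof
    fix f assume f: "f \<in> {f. few_zero_lines n f \<and> \<not> strongly_reconstructible (mat n n f)}"
    then obtain \<pi> \<sigma> where aut: "matrix_automorphism n f \<pi> \<sigma>" and nontrivial: "(\<pi>, \<sigma>) \<noteq> (id, id)"
      using automorphism_if_not_strongly_reconstructible by blast
    show "f \<in> ?A \<union> ?B \<union> ?C \<union> (\<Union>x\<in>?S. E x)"
    proof (rule ccontr)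
      assume no: "f \<notin> ?A \<union> ?B \<union> ?C \<union> (\<Union>x\<in>?S. E x)"
      have "12 * d * m (\<pi>, \<sigma>) \<le> 4 * card {x \<in> moved_cells n \<pi> \<sigma>. f x}"
        using many_ones_in_moved_cells[OF aut, of "12 * d"] f no
        by (simp add: m_def few_zero_lines_def)
      then have "f \<in> E (\<pi>, \<sigma>)"
        using aut by (auto simp: E_def X_def g_def moved_cells_def matrix_automorphism_def)
      moreover have "(\<pi>, \<sigma>) \<in> ?S"
        using aut nontrivial by (auto simp: matrix_automorphism_def)
      ultimately show False using no by blast
    qed
  qed
  then have "?P {f. few_zero_lines n f \<and> \<not> strongly_reconstructible (mat n n f)} \<le> ?P (?A \<union> ?B \<union> ?C \<union> (\<Union>x\<in>?S. E x))"
    by (intro measure_pmf.finite_measure_mono) auto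
  also have "\<dots> \<le> ?P ?A + ?P ?B + ?P ?C + ?P (\<Union>x\<in>?S. E x)"
    by (intro order.trans[OF measure_Un_le] add_mono order.refl) auto
  also have "?P ?B = ?P ?A"
    by (rule prob_random_grid_swap)
  also have "?P (\<Union>x\<in>?S. E x) \<le> (\<Sum>x\<in>?S. ?P (E x))"
    using finS by (intro measure_pmf.finite_measure_subadditive_finite) auto
  also have "(\<Sum>x\<in>?S. ?P (E x)) \<le> (\<Sum>x\<in>?S. 3 * (p ^ d) ^ m x)"
  proof (rule sum_mono)
    fix x assume "x \<in> ?S"
    then obtain \<pi> \<sigma> where x: "x = (\<pi>, \<sigma>)" "\<pi> permutes {..<n}" "\<sigma> permutes {..<n}" by auto
    have inj: "inj (g x)"
      using permutes_inj[OF x(2)] permutes_inj[OF x(3)] by (simp add: x g_def prod.inj_map)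
    have "?P (E x) \<le> 3 * p ^ (d * m x)"
      unfolding E_def
    proof (rule prob_invariant_ones_le[OF _ p])
      show "inj_on (g x) (X x)" using inj by (rule inj_on_subset) simp
      show "g x ` X x \<subseteq> {..<n} \<times> {..<n}"
        using x permutes_in_image[OF x(2)] permutes_in_image[OF x(3)]
        by (auto simp: g_def X_def moved_cells_def)
    qed (auto simp: x g_def X_def moved_cells_def)
    then show "?P (E x) \<le> 3 * (p ^ d) ^ m x" by (simp add: power_mult)
  qed
  also have "\<dots> = 3 * (\<Sum>(\<pi>, \<sigma>)\<in>?S. (p ^ d) ^ (card (moved n \<pi>) + card (moved n \<sigma>)))"
    by (simp add: sum_distrib_left m_def case_prod_unfold)
  also have "\<dots> \<le> 3 * ((1 + p ^ d) ^ (2 * (n * n)) - 1)"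
    using p by (intro mult_left_mono sum_nontrivial_pairs_le) auto
  finally have "?P {f. few_zero_lines n f \<and> \<not> strongly_reconstructible (mat n n f)}
    \<le> 2 * ?P ?A + ?P ?C + 3 * ((1 + p ^ d) ^ (2 * (n * n)) - 1)" by simp
  also have "\<dots> \<le> 2 * (real n ^ 3 * (p ^ 2 * ((1 - p * (1 - t)) ^ (2 * (n - 1)) / t ^ (2 * (12 * d)))))
     + real n ^ 2 * (p * ((1 - p * (1 - t)) ^ (2 * (n - 1)) / t ^ (2 * (12 * d))))
     + 3 * ((1 + p ^ d) ^ (2 * (n * n)) - 1)"
    by (intro add_mono mult_left_mono prob_light_rows_meet_le prob_light_row_meets_light_col_le p t) auto
  also have "\<dots> = ?rhs"
  proof -
    have "2 * (a * (b * x)) + u * (v * x) + w = (2 * a * b + u * v) * x + w" for a b u v w x :: real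
      by (simp add: algebra_simps)
    then show ?thesis by (simp only:) simp
  qed
  finally show ?thesis .
qed

lemma one_minus_power_le_exp:
  fixes x :: real
  assumes "0 \<le> x" "x \<le> 1"
  shows "(1 - x) ^ m \<le> exp (- (x * real m))"
proof -
  have "(1 - x) ^ m \<le> exp (- x) ^ m"
    using assms exp_ge_add_one_self[of "- x"] by (intro power_mono) auto
  also have "\<dots> = exp (- (x * real m))"
    by (simp add: exp_of_nat_mult[symmetric] mult.commute)
  finally show ?thesis .
qed

lemma one_plus_power_le_exp:
  fixes x :: real
  assumes "0 \<le> x"
  shows "(1 + x) ^ m \<le> exp (x * real m)"
proof -
  have "(1 + x) ^ m \<le> exp x ^ m"
    using assms exp_ge_add_one_self[of x] by (intro power_mono) auto
  also have "\<dots> = exp (x * real m)"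
    by (simp add: exp_of_nat_mult[symmetric] mult.commute)
  finally show ?thesis .
qed

text \<open>The loss of 1 in the hypothesis on \<open>L\<close> pays for \<open>n - 1\<close> in place of \<open>n\<close>.\<close>

lemma light_line_factor_le:
  fixes p t :: real
  assumes p: "0 \<le> p" "p \<le> 1" and t: "0 < t" "t \<le> 1" and n: "1 \<le> n"
    and L: "L \<le> p * real n * (1 - t) - 1"
  shows "(1 - p * (1 - t)) ^ (2 * (n - 1)) \<le> exp (- 2 * L)"
proof -
  have "p * (1 - t) \<le> 1" using p t by (intro mult_le_one) auto
  then have "(1 - p * (1 - t)) ^ (2 * (n - 1)) \<le> exp (- (p * (1 - t) * real (2 * (n - 1))))"
    using p t by (intro one_minus_power_le_exp) auto
  also have "p * (1 - t) * real (2 * (n - 1)) = 2 * (p * real n * (1 - t) - p * (1 - t))"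
    using n by (simp add: of_nat_diff algebra_simps)
  also have "exp (- \<dots>) \<le> exp (- 2 * L)"
    using L \<open>p * (1 - t) \<le> 1\<close> by simp
  finally show ?thesis .
qed

text \<open>Near the threshold a line has bounded weight with probability \<open>1 / n\<close> up to logarithmic factors.
  This is obtained with \<open>t = 1 / ln n\<close>, for which \<open>exp (n * p * t)\<close> stays bounded. Here \<open>d = 3\<close> is
  the least value for which \<open>n ^ 2 * p ^ d\<close> tends to 0.\<close>

lemma prob_not_reconstructible_sparse_le:
  fixes p K :: real
  assumes p: "0 \<le> p" "p \<le> 1" and n: "3 \<le> n"
    and lower: "ln (real n) - K \<le> real n * p" and upper: "real n * p \<le> 100 * ln (real n)"
  shows "measure_pmf.prob (random_grid n p) {f. few_zero_lines n f \<and> \<not> strongly_reconstructible (mat n n f)}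
    \<le> (20000 * real n * ln (real n) ^ 2 + 100 * real n * ln (real n)) *
        (exp (2 * (K + 101)) / real n ^ 2 * ln (real n) ^ 72)
      + 3 * (exp (2000000 * ln (real n) ^ 3 / real n) - 1)"
proof -
  define l where "l = ln (real n)"
  have l: "1 \<le> l"
    using n exp_le by (simp add: l_def ln_ge_iff)
  have n0: "0 < real n" using n by simp
  have "(2 * real n ^ 3 * p ^ 2 + real n ^ 2 * p) = 2 * real n * (real n * p) ^ 2 + real n * (real n * p)"
    by (simp add: power2_eq_square power3_eq_cube algebra_simps)
  also have "\<dots> \<le> 2 * real n * (100 * l) ^ 2 + real n * (100 * l)"
    using p upper by (intro add_mono mult_left_mono power_mono) (auto simp: l_def)
  finally have F1: "2 * real n ^ 3 * p ^ 2 + real n ^ 2 * p \<le> 20000 * real n * l ^ 2 + 100 * real n * l"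
    by (simp add: power_mult_distrib)
  (* The constant 101 consists of this 100 and of the 1 lost in light_line_factor_le. *)
  have "p * real n * (1 / l) \<le> 100"
    using upper l by (simp add: l_def field_simps)
  then have "(1 - p * (1 - 1 / l)) ^ (2 * (n - 1)) \<le> exp (- 2 * (l - K - 101))"
    using p l n lower by (intro light_line_factor_le) (auto simp: l_def algebra_simps)
  also have "\<dots> = exp (2 * (K + 101)) / exp l ^ 2"
    by (simp add: exp_diff[symmetric] exp_double[symmetric] algebra_simps)
  finally have F2: "(1 - p * (1 - 1 / l)) ^ (2 * (n - 1)) \<le> exp (2 * (K + 101)) / real n ^ 2"
    using n0 by (simp add: l_def)
  have F3: "(1 + p ^ 3) ^ (2 * (n * n)) \<le> exp (2000000 * l ^ 3 / real n)"
  proof -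
    have "(1 + p ^ 3) ^ (2 * (n * n)) \<le> exp (p ^ 3 * real (2 * (n * n)))"
      using p by (intro one_plus_power_le_exp) auto
    also have "p ^ 3 * real (2 * (n * n)) = 2 * (real n * p) ^ 3 / real n"
      using n0 by (simp add: power3_eq_cube field_simps)
    also have "exp \<dots> \<le> exp (2 * (100 * l) ^ 3 / real n)"
    proof -
      have "(real n * p) ^ 3 \<le> (100 * l) ^ 3"
        using p upper by (intro power_mono) (auto simp: l_def)
      then have "2 * (real n * p) ^ 3 / real n \<le> 2 * (100 * l) ^ 3 / real n"
        by (intro divide_right_mono) auto
      then show ?thesis by (simp only: exp_le_cancel_iff)
    qed
    finally show ?thesis by (simp add: power_mult_distrib)
  qed
  have "measure_pmf.prob (random_grid n p) {f. few_zero_lines n f \<and> \<not> strongly_reconstructible (mat n n f)}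
    \<le> (2 * real n ^ 3 * p ^ 2 + real n ^ 2 * p) * ((1 - p * (1 - 1 / l)) ^ (2 * (n - 1)) / (1 / l) ^ (24 * 3))
      + 3 * ((1 + p ^ 3) ^ (2 * (n * n)) - 1)"
    using p l by (intro prob_not_reconstructible_few_zero_lines_le) auto
  also have "\<dots> = (2 * real n ^ 3 * p ^ 2 + real n ^ 2 * p) * ((1 - p * (1 - 1 / l)) ^ (2 * (n - 1)) * l ^ 72)
      + 3 * ((1 + p ^ 3) ^ (2 * (n * n)) - 1)"
    by (simp add: power_divide)
  also have "\<dots> \<le> (20000 * real n * l ^ 2 + 100 * real n * l) * (exp (2 * (K + 101)) / real n ^ 2 * l ^ 72)
      + 3 * (exp (2000000 * l ^ 3 / real n) - 1)"
    using p l by (intro add_mono mult_mono mult_left_mono diff_right_mono F1 F2 F3 mult_right_mono) auto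
  finally show ?thesis by (simp add: l_def)
qed

text \<open>As \<open>p\<close> may be constant, \<open>n ^ 2 * p ^ d\<close> is small only if \<open>d\<close> is of order \<open>ln n\<close>. Lines are still
  heavy, since their mean weight is at least \<open>100 * ln n\<close> while light means less than
  \<open>12 * d \<le> 48 * ln n + 12\<close>.\<close>

lemma prob_not_reconstructible_dense_le:
  fixes p :: real
  assumes p: "0 \<le> p" "p \<le> 1 / 2" and n: "1 \<le> n" and lower: "100 * ln (real n) \<le> real n * p"
  shows "measure_pmf.prob (random_grid n p) {f. few_zero_lines n f \<and> \<not> strongly_reconstructible (mat n n f)}
    \<le> 3 * real n ^ 3 * exp (26 - 4 * ln (real n))
      + 3 * (exp (2 * real n ^ 2 * exp (- (8 / 3) * ln (real n))) - 1)"
proof -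
  define l where "l = ln (real n)"
  define d where "d = nat \<lceil>4 * l\<rceil>"
  have l: "0 \<le> l" using n by (simp add: l_def)
  have d: "4 * l \<le> real d" "real d \<le> 4 * l + 1"
    using l by (auto simp: d_def)
  have n1: "1 \<le> real n" using n by simp
  have "2 * real n ^ 3 * p ^ 2 + real n ^ 2 * p \<le> 2 * real n ^ 3 * 1 + real n ^ 3 * 1"
    using p n1 by (intro add_mono mult_mono power_increasing power_le_one) auto
  then have F1: "2 * real n ^ 3 * p ^ 2 + real n ^ 2 * p \<le> 3 * real n ^ 3" by simp
  have F2: "(1 - p * (1 - 1 / 2)) ^ (2 * (n - 1)) \<le> exp (- 2 * (50 * l - 1))"
    using p n lower by (intro light_line_factor_le) (auto simp: l_def algebra_simps)
  have ln2: "2 / 3 \<le> ln (2::real)" "ln (2::real) \<le> 1"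
    using ln2_ge_two_thirds ln_2_less_1 by auto
  have pow2: "(2::real) ^ k = exp (real k * ln 2)" for k
    by (simp add: exp_of_nat_mult)
  have "real (24 * d) * ln 2 \<le> (96 * l + 24) * 1"
    using d l ln2 by (intro mult_mono) auto
  then have F3: "(2::real) ^ (24 * d) \<le> exp (96 * l + 24)"
    by (simp only: pow2 exp_le_cancel_iff mult_1_right)
  have "4 * l * (2 / 3) \<le> real d * ln 2"
    using d l ln2 by (intro mult_mono) auto
  moreover have "(1 / 2) ^ d = exp (- (real d * ln 2))"
    by (simp only: power_divide power_one pow2 exp_minus inverse_eq_divide)
  ultimately have "(1 / 2) ^ d \<le> exp (- (8 / 3) * l)"
    by (simp only: exp_le_cancel_iff)
  moreover have "p ^ d \<le> (1 / 2) ^ d" using p by (intro power_mono) auto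
  ultimately have pd: "p ^ d \<le> exp (- (8 / 3) * l)" by linarith
  have "(1 + p ^ d) ^ (2 * (n * n)) \<le> exp (p ^ d * real (2 * (n * n)))"
    using p by (intro one_plus_power_le_exp) auto
  also have "\<dots> \<le> exp (exp (- (8 / 3) * l) * real (2 * (n * n)))"
    using pd by (simp add: mult_right_mono)
  finally have F4: "(1 + p ^ d) ^ (2 * (n * n)) \<le> exp (2 * real n ^ 2 * exp (- (8 / 3) * l))"
    by (simp add: power2_eq_square algebra_simps)
  have "measure_pmf.prob (random_grid n p) {f. few_zero_lines n f \<and> \<not> strongly_reconstructible (mat n n f)}
    \<le> (2 * real n ^ 3 * p ^ 2 + real n ^ 2 * p) * ((1 - p * (1 - 1 / 2)) ^ (2 * (n - 1)) / (1 / 2) ^ (24 * d))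
      + 3 * ((1 + p ^ d) ^ (2 * (n * n)) - 1)"
    using p by (intro prob_not_reconstructible_few_zero_lines_le) auto
  also have "\<dots> = (2 * real n ^ 3 * p ^ 2 + real n ^ 2 * p) * ((1 - p * (1 - 1 / 2)) ^ (2 * (n - 1)) * 2 ^ (24 * d))
      + 3 * ((1 + p ^ d) ^ (2 * (n * n)) - 1)"
    by (simp add: power_divide)
  also have "\<dots> \<le> 3 * real n ^ 3 * (exp (- 2 * (50 * l - 1)) * exp (96 * l + 24))
      + 3 * (exp (2 * real n ^ 2 * exp (- (8 / 3) * l)) - 1)"
    using p by (intro add_mono mult_mono mult_left_mono diff_right_mono F1 F2 F3 F4) auto
  also have "exp (- 2 * (50 * l - 1)) * exp (96 * l + 24) = exp (26 - 4 * l)"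
    by (simp add: exp_add[symmetric])
  finally show ?thesis by (simp add: l_def)
qed

text \<open>At and above the threshold, repeated zero lines are the only obstruction of non-vanishing
  probability.\<close>

lemma reconstructible_if_few_zero_lines_whp:
  fixes p :: "nat \<Rightarrow> real"
  assumes p: "\<And>n. n \<ge> 1 \<Longrightarrow> 0 \<le> p n" "\<And>n. n \<ge> 1 \<Longrightarrow> p n \<le> 1 / 2"
    and lower: "eventually (\<lambda>n. ln (real n) - K \<le> real n * p n) sequentially"
  shows "(\<lambda>n. measure_pmf.prob (random_grid n (p n))
      {f. few_zero_lines n f \<and> \<not> strongly_reconstructible (mat n n f)}) \<longlonglongrightarrow> 0"
proof -
  define s where "s = (\<lambda>n. (20000 * real n * ln (real n) ^ 2 + 100 * real n * ln (real n)) *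
        (exp (2 * (K + 101)) / real n ^ 2 * ln (real n) ^ 72)
      + 3 * (exp (2000000 * ln (real n) ^ 3 / real n) - 1))"
  define u where "u = (\<lambda>n. 3 * real n ^ 3 * exp (26 - 4 * ln (real n))
      + 3 * (exp (2 * real n ^ 2 * exp (- (8 / 3) * ln (real n))) - 1))"
  have s: "s \<longlonglongrightarrow> 0" unfolding s_def by real_asymp
  have u: "u \<longlonglongrightarrow> 0" unfolding u_def by real_asymp
  have lim: "(\<lambda>n. \<bar>s n\<bar> + \<bar>u n\<bar>) \<longlonglongrightarrow> 0"
    using tendsto_add[OF tendsto_rabs_zero[OF s] tendsto_rabs_zero[OF u]] by simp
  have upper: "eventually (\<lambda>n. measure_pmf.prob (random_grid n (p n))
      {f. few_zero_lines n f \<and> \<not> strongly_reconstructible (mat n n f)} \<le> \<bar>s n\<bar> + \<bar>u n\<bar>) sequentially"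
    using lower eventually_ge_at_top[of 3]
  proof eventually_elim
    case (elim n)
    have pn: "0 \<le> p n" "p n \<le> 1" "p n \<le> 1 / 2"
      using p[of n] elim by auto
    show ?case
    proof (cases "real n * p n \<le> 100 * ln (real n)")
      case True
      then show ?thesis
        using prob_not_reconstructible_sparse_le[of "p n" n K] pn elim
        unfolding s_def by linarith
    next
      case False
      then show ?thesis
        using prob_not_reconstructible_dense_le[of "p n" n] pn elim
        unfolding u_def by linarith
    qed
  qed
  show ?thesis
    by (rule tendsto_sandwich[OF _ upper tendsto_const lim]) simp
qed

section \<open>The number of zero rows and zero columns\<close>

text \<open>The probability that a binomial variable with parameters \<open>n\<close> and \<open>x\<close> is at most 1.\<close>

definition binomial_at_most_one :: "nat \<Rightarrow> real \<Rightarrow> real" where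
  "binomial_at_most_one n x = (1 - x) ^ n + real n * x * (1 - x) ^ (n - 1)"

text \<open>The weight in inclusion-exclusion for the event that at most one of given events occurs: the
  weights of the subsets of an \<open>A\<close> add up to 1 if \<open>A\<close> has at most one element and to 0 otherwise.\<close>

definition at_most_one_sign :: "'a set \<Rightarrow> real" where
  "at_most_one_sign R = (- 1) ^ card R * (1 - real (card R))"

lemma sum_Pow_at_most_one_sign:
  assumes "finite A"
  shows "(\<Sum>R\<in>Pow A. at_most_one_sign R * x ^ card R) = binomial_at_most_one (card A) x"
proof -
  have first_moment: "(\<Sum>R\<in>Pow A. real (card R) * (- x) ^ card R) = - (real (card A) * x * (1 - x) ^ (card A - 1))"
    using assms
  proof (induction A rule: finite_induct)
    case (insert a A)
    have "(\<Sum>R\<in>Pow (insert a A). real (card R) * (- x) ^ card R)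
        = (\<Sum>R\<in>Pow A. real (card R) * (- x) ^ card R)
        + (\<Sum>R\<in>insert a ` Pow A. real (card R) * (- x) ^ card R)"
      unfolding Pow_insert using insert by (intro sum.union_disjoint) auto
    also have "(\<Sum>R\<in>insert a ` Pow A. real (card R) * (- x) ^ card R)
        = (\<Sum>R\<in>Pow A. real (card (insert a R)) * (- x) ^ card (insert a R))"
      using insert by (subst sum.reindex) (auto simp: inj_on_def)
    also have "\<dots> = (\<Sum>R\<in>Pow A. - x * (real (card R) * (- x) ^ card R) - x * (- x) ^ card R)"
    proof (intro sum.cong refl)
      fix R assume "R \<in> Pow A"
      then have "finite R" "a \<notin> R" using insert finite_subset by auto
      then show "real (card (insert a R)) * (- x) ^ card (insert a R)
          = - x * (real (card R) * (- x) ^ card R) - x * (- x) ^ card R"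
        by (simp add: algebra_simps)
    qed
    also have "\<dots> = - x * (\<Sum>R\<in>Pow A. real (card R) * (- x) ^ card R) - x * (1 - x) ^ card A"
      using insert sum_Pow_power_card[of A "- x"] by (simp add: sum_subtractf sum_distrib_left[symmetric] sum_negf)
    finally show ?case
      using insert by (cases "card A") (simp_all add: algebra_simps)
  qed auto
  have "(\<Sum>R\<in>Pow A. at_most_one_sign R * x ^ card R)
      = (\<Sum>R\<in>Pow A. (- x) ^ card R - real (card R) * (- x) ^ card R)"
    by (intro sum.cong refl) (simp add: at_most_one_sign_def power_minus[of x] algebra_simps)
  also have "\<dots> = (1 - x) ^ card A + real (card A) * x * (1 - x) ^ (card A - 1)"
    using sum_Pow_power_card[OF assms, of "- x"] first_moment by (simp add: sum_subtractf)
  finally show ?thesis by (simp add: binomial_at_most_one_def)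
qed

lemma sum_Pow_at_most_one_sign_indicator:
  assumes "finite B" "A \<subseteq> B"
  shows "(\<Sum>R\<in>Pow B. at_most_one_sign R * of_bool (R \<subseteq> A)) = of_bool (card A \<le> 1)"
proof -
  have fin: "finite A" using assms finite_subset by blast
  have "(\<Sum>R\<in>Pow B. at_most_one_sign R * of_bool (R \<subseteq> A)) = (\<Sum>R\<in>Pow A. at_most_one_sign R * 1 ^ card R)"
    using assms by (intro sum.mono_neutral_cong_right) auto
  also have "\<dots> = binomial_at_most_one (card A) 1"
    using fin by (rule sum_Pow_at_most_one_sign)
  also have "\<dots> = of_bool (card A \<le> 1)"
    by (auto simp: binomial_at_most_one_def power_0_left)
  finally show ?thesis .
qed

text \<open>The cells that have to vanish are the full columns in \<open>S\<close> and, for each row in \<open>R\<close>, its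
  \<open>n - card S\<close> remaining cells.\<close>

lemma prob_zero_lines_superset:
  assumes p: "0 \<le> p" "p \<le> 1" and RS: "R \<subseteq> {..<n}" "S \<subseteq> {..<n}"
  shows "measure_pmf.prob (random_grid n p) {f. R \<subseteq> zero_rows n f \<and> S \<subseteq> zero_cols n f}
    = (1 - p) ^ (n * card S) * ((1 - p) ^ (n - card S)) ^ card R"
proof -
  let ?T = "{..<n} \<times> S \<union> R \<times> ({..<n} - S)"
  have fin: "finite R" "finite S" using RS finite_subset by blast+
  have "{f. R \<subseteq> zero_rows n f \<and> S \<subseteq> zero_cols n f} = {f. (\<forall>x\<in>{}. f x) \<and> (\<forall>x\<in>?T. \<not> f x)}"
    using RS by (auto simp: zero_rows_def zero_cols_def subset_iff)
  also have "measure_pmf.prob (random_grid n p) \<dots> = p ^ card ({} :: (nat \<times> nat) set) * (1 - p) ^ card ?T"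
    using p RS by (intro prob_bits_prescribed) auto
  also have "card ?T = card ({..<n} \<times> S) + card (R \<times> ({..<n} - S))"
    using fin by (intro card_Un_disjoint) auto
  also have "\<dots> = n * card S + (n - card S) * card R"
    using fin RS by (simp add: card_cartesian_product card_Diff_subset)
  finally show ?thesis by (simp add: power_add power_mult)
qed

lemma prob_at_most_one_zero_row:
  assumes p: "0 \<le> p" "p \<le> 1"
  shows "measure_pmf.prob (random_grid n p) {f. card (zero_rows n f) \<le> 1} = binomial_at_most_one n ((1 - p) ^ n)"
proof -
  let ?M = "random_grid n p"
  let ?Z = "\<lambda>R. {f. R \<subseteq> zero_rows n f}"
  have Z: "measure_pmf.prob ?M (?Z R) = ((1 - p) ^ n) ^ card R" if "R \<in> Pow {..<n}" for R
    using prob_zero_lines_superset[OF p, of R n "{}"] that by simp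
  have "measure_pmf.prob ?M {f. card (zero_rows n f) \<le> 1}
      = measure_pmf.expectation ?M (\<lambda>f. of_bool (card (zero_rows n f) \<le> 1))"
    by (rule prob_eq_expectation_of_bool)
  also have "\<dots> = measure_pmf.expectation ?M (\<lambda>f. \<Sum>R\<in>Pow {..<n}. at_most_one_sign R * indicator (?Z R) f)"
  proof (intro Bochner_Integration.integral_cong refl)
    fix f
    have "of_bool (card (zero_rows n f) \<le> 1) = (\<Sum>R\<in>Pow {..<n}. at_most_one_sign R * of_bool (R \<subseteq> zero_rows n f))"
      by (subst sum_Pow_at_most_one_sign_indicator) (auto simp: zero_rows_def)
    then show "of_bool (card (zero_rows n f) \<le> 1) = (\<Sum>R\<in>Pow {..<n}. at_most_one_sign R * indicator (?Z R) f)"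
      by (simp add: indicator_def)
  qed
  also have "\<dots> = (\<Sum>R\<in>Pow {..<n}. at_most_one_sign R * measure_pmf.prob ?M (?Z R))"
    by (subst Bochner_Integration.integral_sum) (auto intro!: integrable_mult_right)
  also have "\<dots> = (\<Sum>R\<in>Pow {..<n}. at_most_one_sign R * ((1 - p) ^ n) ^ card R)"
    using Z by (intro sum.cong) auto
  finally show ?thesis
    by (simp add: sum_Pow_at_most_one_sign)
qed

lemma sum_Pow_by_card:
  assumes "finite A"
  shows "(\<Sum>S\<in>Pow A. h (card S)) = (\<Sum>s\<le>card A. real (card A choose s) * h s)"
proof -
  have "(\<Sum>S\<in>Pow A. h (card S)) = (\<Sum>s\<le>card A. \<Sum>S | S \<in> Pow A \<and> card S = s. h (card S))"
    using assms by (intro sum.group[symmetric]) (auto intro: card_mono)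
  also have "\<dots> = (\<Sum>s\<le>card A. \<Sum>S | S \<in> Pow A \<and> card S = s. h s)"
    by (intro sum.cong) auto
  also have "\<dots> = (\<Sum>s\<le>card A. real (card A choose s) * h s)"
    using assms n_subsets[OF assms] by (intro sum.cong) auto
  finally show ?thesis .
qed

text \<open>Inclusion-exclusion over the sets \<open>S\<close> of zero columns. If \<open>s\<close> columns vanish, then the rows are
  independent and each vanishes with probability \<open>(1 - p) ^ (n - s)\<close>, so the sum over the sets of
  zero rows has the closed form above. Summing only over columns keeps the terms dominated by a
  convergent series; in the sum over both sides they grow like \<open>(1 - p)\<close> to the power \<open>- r * s\<close>.\<close>

lemma prob_few_zero_lines:
  assumes p: "0 \<le> p" "p \<le> 1"
  shows "measure_pmf.prob (random_grid n p) {f. few_zero_lines n f}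
    = (\<Sum>s\<le>n. real (n choose s) * ((- 1) ^ s * (1 - real s) * (1 - p) ^ (n * s)
          * binomial_at_most_one n ((1 - p) ^ (n - s))))"
proof -
  let ?M = "random_grid n p"
  let ?Z = "\<lambda>R S. {f. R \<subseteq> zero_rows n f \<and> S \<subseteq> zero_cols n f}"
  let ?P = "Pow {..<n}"
  have "measure_pmf.prob ?M {f. few_zero_lines n f}
      = measure_pmf.expectation ?M (\<lambda>f. of_bool (few_zero_lines n f))"
    by (rule prob_eq_expectation_of_bool)
  also have "\<dots> = measure_pmf.expectation ?M
      (\<lambda>f. \<Sum>S\<in>?P. \<Sum>R\<in>?P. at_most_one_sign S * at_most_one_sign R * indicator (?Z R S) f)"
  proof (intro Bochner_Integration.integral_cong refl)
    fix f
    have "of_bool (few_zero_lines n f) =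
       (of_bool (card (zero_cols n f) \<le> 1) * of_bool (card (zero_rows n f) \<le> 1) :: real)"
      by (auto simp: few_zero_lines_def)
    also have "\<dots> = (\<Sum>S\<in>?P. at_most_one_sign S * of_bool (S \<subseteq> zero_cols n f))
        * (\<Sum>R\<in>?P. at_most_one_sign R * of_bool (R \<subseteq> zero_rows n f))"
      by (subst (1 2) sum_Pow_at_most_one_sign_indicator) (auto simp: zero_rows_def zero_cols_def)
    also have "\<dots> = (\<Sum>S\<in>?P. \<Sum>R\<in>?P. at_most_one_sign S * at_most_one_sign R * indicator (?Z R S) f)"
      unfolding sum_product by (intro sum.cong refl) (auto simp: indicator_def)
    finally show "of_bool (few_zero_lines n f) = \<dots>" .
  qed
  also have "\<dots> = (\<Sum>S\<in>?P. \<Sum>R\<in>?P. at_most_one_sign S * at_most_one_sign R * measure_pmf.prob ?M (?Z R S))"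
  proof -
    have int: "integrable (measure_pmf ?M) (\<lambda>f. at_most_one_sign S * at_most_one_sign R * indicator (?Z R S) f)" for R S
      by (intro integrable_mult_right integrable_indicator_pmf)
    show ?thesis
      by (subst Bochner_Integration.integral_sum, intro Bochner_Integration.integrable_sum int)
        (intro sum.cong refl, subst Bochner_Integration.integral_sum[OF int], simp)
  qed
  also have "\<dots> = (\<Sum>S\<in>?P. at_most_one_sign S * (1 - p) ^ (n * card S)
      * (\<Sum>R\<in>?P. at_most_one_sign R * ((1 - p) ^ (n - card S)) ^ card R))"
    using prob_zero_lines_superset[OF p]
    by (intro sum.cong refl) (simp add: sum_distrib_left mult_ac)
  also have "\<dots> = (\<Sum>S\<in>?P. (- 1) ^ card S * (1 - real (card S)) * (1 - p) ^ (n * card S)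
      * binomial_at_most_one n ((1 - p) ^ (n - card S)))"
    by (subst sum_Pow_at_most_one_sign) (simp_all add: at_most_one_sign_def)
  finally show ?thesis
    by (simp add: sum_Pow_by_card[where h = "\<lambda>s. (- 1) ^ s * (1 - real s) * (1 - p) ^ (n * s)
          * binomial_at_most_one n ((1 - p) ^ (n - s))"])
qed

lemma binomial_at_most_one_bounds:
  assumes "0 \<le> x" "x \<le> 1"
  shows "0 \<le> binomial_at_most_one n x" "binomial_at_most_one n x \<le> 1"
proof -
  show "0 \<le> binomial_at_most_one n x"
    using assms by (simp add: binomial_at_most_one_def)
  show "binomial_at_most_one n x \<le> 1"
  proof (induction n)
    case (Suc n)
    have "binomial_at_most_one (Suc n) x = (1 - x) * binomial_at_most_one n x + x * (1 - x) ^ n"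
      by (cases n) (simp_all add: binomial_at_most_one_def algebra_simps)
    also have "\<dots> \<le> (1 - x) * 1 + x * 1"
      using assms Suc by (intro add_mono mult_left_mono power_le_one) auto
    finally show ?case by simp
  qed (simp add: binomial_at_most_one_def)
qed

section \<open>Limits\<close>

text \<open>In exponential form, the second-order error of \<open>ln (1 - x) = - x + O(x ^ 2)\<close> is multiplied by \<open>n\<close>.\<close>

lemma power_one_minus_limit:
  fixes x a :: "nat \<Rightarrow> real"
  assumes x: "eventually (\<lambda>n. \<bar>x n\<bar> \<le> 1 / 2) sequentially"
    and sq: "(\<lambda>n. real n * x n ^ 2) \<longlonglongrightarrow> 0"
    and lim: "(\<lambda>n. real n * x n - a n) \<longlonglongrightarrow> \<mu>"
  shows "(\<lambda>n. exp (a n) * (1 - x n) ^ n) \<longlonglongrightarrow> exp (- \<mu>)"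
proof -
  have "(\<lambda>n. real n * (ln (1 - x n) + x n)) \<longlonglongrightarrow> 0"
  proof (rule Lim_null_comparison)
    show "(\<lambda>n. 2 * (real n * x n ^ 2)) \<longlonglongrightarrow> 0"
      using tendsto_mult_left[OF sq, of 2] by simp
    show "eventually (\<lambda>n. norm (real n * (ln (1 - x n) + x n)) \<le> 2 * (real n * x n ^ 2)) sequentially"
      using x
    proof eventually_elim
      case (elim n)
      then have "\<bar>ln (1 + (- x n)) - (- x n)\<bar> \<le> 2 * (- x n) ^ 2"
        by (intro abs_ln_one_plus_x_minus_x_bound) auto
      then show ?case
        by (simp add: abs_mult mult_left_mono mult.left_commute)
    qed
  qed
  from tendsto_diff[OF this lim]
  have "(\<lambda>n. exp (real n * (ln (1 - x n) + x n) - (real n * x n - a n))) \<longlonglongrightarrow> exp (0 - \<mu>)"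
    by (rule tendsto_exp)
  moreover have "eventually (\<lambda>n. exp (real n * (ln (1 - x n) + x n) - (real n * x n - a n))
      = exp (a n) * (1 - x n) ^ n) sequentially"
    using x
  proof eventually_elim
    case (elim n)
    then have "(1 - x n) ^ n = exp (real n * ln (1 - x n))"
      by (simp add: exp_of_nat_mult)
    then show ?case by (simp add: exp_add[symmetric] algebra_simps)
  qed
  ultimately show ?thesis
    by (auto elim: Lim_transform_eventually)
qed

lemma power_diff_limit:
  fixes x b :: "nat \<Rightarrow> real"
  assumes "(\<lambda>n. b n * (1 - x n) ^ n) \<longlonglongrightarrow> L" "x \<longlonglongrightarrow> 0" "eventually (\<lambda>n. x n < 1) sequentially"
  shows "(\<lambda>n. b n * (1 - x n) ^ (n - s)) \<longlonglongrightarrow> L"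
proof -
  have "(\<lambda>n. b n * (1 - x n) ^ n / (1 - x n) ^ s) \<longlonglongrightarrow> L / (1 - 0) ^ s"
    using assms by (intro tendsto_intros) auto
  moreover have "eventually (\<lambda>n. b n * (1 - x n) ^ n / (1 - x n) ^ s = b n * (1 - x n) ^ (n - s)) sequentially"
    using assms(3) eventually_ge_at_top[of s]
    by eventually_elim (simp add: power_diff)
  ultimately show ?thesis
    by (auto elim: Lim_transform_eventually)
qed

lemma binomial_at_most_one_Poisson_limit:
  fixes x :: "nat \<Rightarrow> real"
  assumes lim: "(\<lambda>n. real n * x n) \<longlonglongrightarrow> \<mu>"
  shows "(\<lambda>n. binomial_at_most_one n (x n)) \<longlonglongrightarrow> (1 + \<mu>) * exp (- \<mu>)"
proof -
  have inv: "(\<lambda>n. 1 / real n) \<longlonglongrightarrow> 0" by real_asymp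
  have "(\<lambda>n. real n * x n * (1 / real n)) \<longlonglongrightarrow> 0"
    using tendsto_mult[OF lim inv] by simp
  then have x0: "x \<longlonglongrightarrow> 0"
    by (rule Lim_transform_eventually) (use eventually_gt_at_top[of 0] in \<open>eventually_elim, simp\<close>)
  have sq: "(\<lambda>n. real n * x n ^ 2) \<longlonglongrightarrow> 0"
    using tendsto_mult[OF lim x0] by (simp add: power2_eq_square mult.assoc)
  have "eventually (\<lambda>n. \<bar>x n\<bar> < 1 / 2) sequentially"
    using tendsto_rabs_zero[OF x0] by (rule order_tendstoD) auto
  then have half: "eventually (\<lambda>n. \<bar>x n\<bar> \<le> 1 / 2) sequentially" "eventually (\<lambda>n. x n < 1) sequentially"
    by (auto elim: eventually_mono)
  have "(\<lambda>n. exp 0 * (1 - x n) ^ n) \<longlonglongrightarrow> exp (- \<mu>)"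
    using lim by (intro power_one_minus_limit half sq) simp
  then have pow: "(\<lambda>n. 1 * (1 - x n) ^ n) \<longlonglongrightarrow> exp (- \<mu>)" by simp
  have "(\<lambda>n. 1 * (1 - x n) ^ n + real n * x n * (1 * (1 - x n) ^ (n - 1))) \<longlonglongrightarrow> exp (- \<mu>) + \<mu> * exp (- \<mu>)"
    by (intro tendsto_add tendsto_mult lim pow power_diff_limit x0 half)
  then show ?thesis
    by (simp add: binomial_at_most_one_def[abs_def] algebra_simps)
qed

lemma binomial_power_limit:
  "(\<lambda>n. real (n choose s) / real n ^ s) \<longlonglongrightarrow> 1 / fact s"
proof -
  have "(\<lambda>n. (\<Prod>i<s. 1 - real i / real n) / fact s) \<longlonglongrightarrow> (\<Prod>i<s. 1 - 0) / fact s"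
    by (intro tendsto_divide tendsto_prod tendsto_diff tendsto_const) (real_asymp | simp)+
  moreover have "eventually (\<lambda>n. (\<Prod>i<s. 1 - real i / real n) / fact s = real (n choose s) / real n ^ s) sequentially"
    using eventually_gt_at_top[of 0]
  proof eventually_elim
    case (elim n)
    have "real (n choose s) = (\<Prod>i<s. real n - real i) / fact s"
      by (simp add: binomial_gbinomial gbinomial_prod_rev atLeast0LessThan)
    also have "(\<Prod>i<s. real n - real i) = (\<Prod>i<s. real n * (1 - real i / real n))"
      using elim by (intro prod.cong) (auto simp: field_simps)
    also have "\<dots> = real n ^ s * (\<Prod>i<s. 1 - real i / real n)"
      by (simp add: prod.distrib)
    finally show ?case using elim by simp
  qed
  ultimately show ?thesis
    by (auto elim: Lim_transform_eventually)
qed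

lemma alternating_exp_sums:
  fixes \<mu> :: real
  shows "(\<lambda>s. (- 1) ^ s * (1 - real s) * \<mu> ^ s / fact s) sums ((1 + \<mu>) * exp (- \<mu>))"
proof -
  have e: "(\<lambda>s. (- \<mu>) ^ s / fact s) sums exp (- \<mu>)"
    using exp_converges[of "- \<mu>"] by (simp add: divide_inverse mult.commute)
  have "(\<lambda>s. - \<mu> * ((- \<mu>) ^ s / fact s)) sums (- \<mu> * exp (- \<mu>))"
    using e by (rule sums_mult)
  also have "(\<lambda>s. - \<mu> * ((- \<mu>) ^ s / fact s)) = (\<lambda>s. real (Suc s) * (- \<mu>) ^ Suc s / fact (Suc s))"
    by (simp add: fun_eq_iff field_simps del: of_nat_Suc)
  finally have "(\<lambda>s. real s * (- \<mu>) ^ s / fact s) sums (- \<mu> * exp (- \<mu>))"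
    by (subst (asm) sums_Suc_iff) simp
  from sums_diff[OF e this] show ?thesis
    by (simp add: power_minus[of \<mu>] algebra_simps diff_divide_distrib)
qed

text \<open>The binomial factor has the same Poisson limit for every fixed \<open>s\<close>, so it splits off: the numbers
  of zero rows and of zero columns become independent. The terms are dominated by
  \<open>(2 * B) ^ s / fact s\<close> for any bound \<open>B\<close> of \<open>n * (1 - p) ^ n\<close>, so Tannery's theorem applies.\<close>

lemma prob_few_zero_lines_limit:
  fixes p :: "nat \<Rightarrow> real"
  assumes p: "\<And>n. n \<ge> 1 \<Longrightarrow> 0 \<le> p n" "\<And>n. n \<ge> 1 \<Longrightarrow> p n \<le> 1"
    and lim: "\<And>s. (\<lambda>n. real n * (1 - p n) ^ (n - s)) \<longlonglongrightarrow> \<mu>"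
  shows "(\<lambda>n. measure_pmf.prob (random_grid n (p n)) {f. few_zero_lines n f}) \<longlonglongrightarrow> ((1 + \<mu>) * exp (- \<mu>))\<^sup>2"
proof -
  define H where "H = (1 + \<mu>) * exp (- \<mu>)"
  define a where "a = (\<lambda>s n. real (n choose s) * ((- 1) ^ s * (1 - real s) * (1 - p n) ^ (n * s)
          * binomial_at_most_one n ((1 - p n) ^ (n - s))))"
  define b where "b = (\<lambda>s. (- 1) ^ s * (1 - real s) * \<mu> ^ s / fact s * H)"
  have lim0: "(\<lambda>n. real n * (1 - p n) ^ n) \<longlonglongrightarrow> \<mu>"
    using lim[of 0] by simp
  define B where "B = \<bar>\<mu>\<bar> + 1"
  have "eventually (\<lambda>n. real n * (1 - p n) ^ n < B) sequentially"
    using lim0 by (rule order_tendstoD) (auto simp: B_def)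
  then have evB: "eventually (\<lambda>n. 1 \<le> n \<and> real n * (1 - p n) ^ n \<le> B) sequentially"
    using eventually_ge_at_top[of 1] by eventually_elim auto
  have "a s \<longlonglongrightarrow> b s" for s
  proof -
    have "(\<lambda>n. (- 1) ^ s * (1 - real s) * (real (n choose s) / real n ^ s * (real n * (1 - p n) ^ n) ^ s
        * binomial_at_most_one n ((1 - p n) ^ (n - s))))
      \<longlonglongrightarrow> (- 1) ^ s * (1 - real s) * (1 / fact s * \<mu> ^ s * H)"
      unfolding H_def
      by (intro tendsto_mult tendsto_const binomial_power_limit tendsto_power lim0
          binomial_at_most_one_Poisson_limit lim)
    moreover have "eventually (\<lambda>n. (- 1) ^ s * (1 - real s) * (real (n choose s) / real n ^ s
        * (real n * (1 - p n) ^ n) ^ s * binomial_at_most_one n ((1 - p n) ^ (n - s))) = a s n) sequentially"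
      using eventually_gt_at_top[of 0]
      by eventually_elim (simp add: a_def power_mult_distrib power_mult)
    ultimately show ?thesis
      by (auto simp: b_def mult.assoc elim: Lim_transform_eventually)
  qed
  moreover have "eventually (\<lambda>(s, n). norm (a s n) \<le> (2 * B) ^ s / fact s) (at_top \<times>\<^sub>F sequentially)"
  proof -
    have bound: "norm (a s n) \<le> (2 * B) ^ s / fact s" if n: "1 \<le> n" "real n * (1 - p n) ^ n \<le> B" for s n
    proof -
      have pn: "0 \<le> 1 - p n" "1 - p n \<le> 1" using p n by auto
      have "real (n choose s) * fact s \<le> real n ^ s"
        using binomial_fact_pow[of n s] by (metis of_nat_fact of_nat_le_iff of_nat_mult of_nat_power)
      then have ch: "real (n choose s) \<le> real n ^ s / fact s"
        by (simp add: field_simps)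
      have "\<bar>1 - real s\<bar> \<le> 2 ^ s"
      proof -
        have "real s < 2 ^ s" by (rule of_nat_less_two_power)
        then show ?thesis by (cases s) auto
      qed
      moreover have "\<bar>binomial_at_most_one n ((1 - p n) ^ (n - s))\<bar> \<le> 1"
        using binomial_at_most_one_bounds[of "(1 - p n) ^ (n - s)" n] pn by (simp add: power_le_one)
      ultimately have "real (n choose s) * (\<bar>1 - real s\<bar> * (1 - p n) ^ (n * s)
          * \<bar>binomial_at_most_one n ((1 - p n) ^ (n - s))\<bar>)
        \<le> (real n ^ s / fact s) * (2 ^ s * (1 - p n) ^ (n * s) * 1)"
        using pn by (intro mult_mono ch order.refl mult_nonneg_nonneg zero_le_power abs_ge_zero) auto
      moreover have "norm (a s n) = real (n choose s) * (\<bar>1 - real s\<bar> * (1 - p n) ^ (n * s)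
          * \<bar>binomial_at_most_one n ((1 - p n) ^ (n - s))\<bar>)"
        using pn by (simp add: a_def abs_mult power_abs)
      ultimately have "norm (a s n) \<le> (real n ^ s / fact s) * (2 ^ s * (1 - p n) ^ (n * s) * 1)"
        by simp
      also have "\<dots> = 2 ^ s * (real n * (1 - p n) ^ n) ^ s / fact s"
        by (simp add: power_mult_distrib power_mult)
      also have "\<dots> \<le> 2 ^ s * B ^ s / fact s"
        using pn n by (intro divide_right_mono mult_left_mono power_mono) auto
      finally show ?thesis by (simp add: power_mult_distrib)
    qed
    show ?thesis
      unfolding eventually_prod_filter
      by (intro exI[of _ "\<lambda>_. True"] exI[of _ "\<lambda>n. 1 \<le> n \<and> real n * (1 - p n) ^ n \<le> B"]) (use evB bound in auto)
  qed
  moreover have "summable (\<lambda>s. (2 * B) ^ s / fact s)"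
    using summable_exp[of "2 * B"] by (simp add: divide_inverse mult.commute)
  ultimately have "(\<lambda>n. suminf (\<lambda>s. a s n)) \<longlonglongrightarrow> suminf b"
    using tannerys_theorem[of a b sequentially "\<lambda>s. (2 * B) ^ s / fact s"] by simp
  moreover have "b sums (H * H)"
    unfolding b_def by (rule sums_mult2) (use alternating_exp_sums[of \<mu>] in \<open>simp add: H_def\<close>)
  then have "suminf b = H\<^sup>2"
    by (simp add: sums_iff power2_eq_square)
  moreover have "suminf (\<lambda>s. a s n) = (\<Sum>s\<le>n. a s n)" for n
    by (intro suminf_finite) (auto simp: a_def)
  moreover have "eventually (\<lambda>n. (\<Sum>s\<le>n. a s n) = measure_pmf.prob (random_grid n (p n)) {f. few_zero_lines n f}) sequentially"
    using eventually_ge_at_top[of 1]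
    by eventually_elim (use p in \<open>simp add: prob_few_zero_lines a_def\<close>)
  ultimately show ?thesis
    unfolding H_def by (auto elim: Lim_transform_eventually)
qed

section \<open>The threshold\<close>

lemma prob_random_matrix:
  "measure_pmf.prob (random_matrix n q) {M. Q M} = measure_pmf.prob (random_grid n q) {f. Q (mat n n f)}"
  by (simp add: random_matrix_def vimage_def)

text \<open>Strong reconstructibility forces distinct lines, hence at most one zero line on each side.\<close>

lemma prob_strongly_reconstructible:
  "measure_pmf.prob (random_matrix n q) {M. strongly_reconstructible M} =
     measure_pmf.prob (random_grid n q) {f. few_zero_lines n f} -
     measure_pmf.prob (random_grid n q) {f. few_zero_lines n f \<and> \<not> strongly_reconstructible (mat n n f)}"
proof -
  have "{f. strongly_reconstructible (mat n n f)} =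
      {f. few_zero_lines n f} - {f. few_zero_lines n f \<and> \<not> strongly_reconstructible (mat n n f)}"
    using zero_lines_le_one_if_strongly_reconstructible by (auto simp: few_zero_lines_def)
  then show ?thesis
    unfolding prob_random_matrix
    by (simp only:) (intro measure_pmf.finite_measure_Diff, auto)
qed

lemma prob_not_few_zero_lines_le:
  assumes p: "0 \<le> p" "p \<le> 1"
  shows "measure_pmf.prob (random_grid n p) {f. \<not> few_zero_lines n f} \<le> 2 * (real n * (1 - p) ^ n)"
proof -
  let ?P = "measure_pmf.prob (random_grid n p)"
  let ?R = "\<Union>i\<in>{..<n}. {f. {i} \<subseteq> zero_rows n f \<and> {} \<subseteq> zero_cols n f}"
  let ?C = "\<Union>j\<in>{..<n}. {f. {} \<subseteq> zero_rows n f \<and> {j} \<subseteq> zero_cols n f}"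
  have "{f. \<not> few_zero_lines n f} \<subseteq> ?R \<union> ?C"
  proof
    fix f assume "f \<in> {f. \<not> few_zero_lines n f}"
    then have "zero_rows n f \<noteq> {} \<or> zero_cols n f \<noteq> {}"
      by (auto simp: few_zero_lines_def)
    then show "f \<in> ?R \<union> ?C"
      by (auto simp: zero_rows_def zero_cols_def)
  qed
  then have "?P {f. \<not> few_zero_lines n f} \<le> ?P (?R \<union> ?C)"
    by (intro measure_pmf.finite_measure_mono) auto
  also have "\<dots> \<le> ?P ?R + ?P ?C"
    by (intro measure_Un_le) auto
  also have "?P ?R \<le> real (card {..<n}) * (1 - p) ^ n"
  proof (rule prob_UN_le[OF finite_lessThan subset_refl])
    show "?P {f. {i} \<subseteq> zero_rows n f \<and> {} \<subseteq> zero_cols n f} \<le> (1 - p) ^ n" if "i \<in> {..<n}" for i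
      using that p by (subst prob_zero_lines_superset) auto
  qed
  also have "?P ?C \<le> real (card {..<n}) * (1 - p) ^ n"
  proof (rule prob_UN_le[OF finite_lessThan subset_refl])
    show "?P {f. {} \<subseteq> zero_rows n f \<and> {j} \<subseteq> zero_cols n f} \<le> (1 - p) ^ n" if "j \<in> {..<n}" for j
      using that p by (subst prob_zero_lines_superset) auto
  qed
  finally show ?thesis by simp
qed

lemma binomial_at_most_one_le_exp:
  assumes "0 \<le> x" "x \<le> 1" "1 \<le> n"
  shows "binomial_at_most_one n x \<le> (1 + exp 1 * (real n * x)) * exp (- (real n * x))"
proof -
  have "(1 - x) ^ n \<le> exp (- (x * real n))"
    using assms by (intro one_minus_power_le_exp) auto
  moreover have "(1 - x) ^ (n - 1) \<le> exp 1 * exp (- (x * real n))"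
  proof -
    have "(1 - x) ^ (n - 1) \<le> exp (- (x * real (n - 1)))"
      using assms by (intro one_minus_power_le_exp) auto
    also have "\<dots> \<le> exp (1 - x * real n)"
      using assms by (simp add: of_nat_diff algebra_simps)
    finally show ?thesis by (simp add: exp_diff exp_minus field_simps)
  qed
  then have "real n * x * (1 - x) ^ (n - 1) \<le> real n * x * (exp 1 * exp (- (x * real n)))"
    using assms by (intro mult_left_mono) auto
  ultimately show ?thesis
    by (simp add: binomial_at_most_one_def algebra_simps)
qed

lemma at_most_one_zero_row_vanishes:
  fixes p :: "nat \<Rightarrow> real"
  assumes p: "\<And>n. n \<ge> 1 \<Longrightarrow> 0 \<le> p n" "\<And>n. n \<ge> 1 \<Longrightarrow> p n \<le> 1"
    and lim: "filterlim (\<lambda>n. real n * (1 - p n) ^ n) at_top sequentially"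
  shows "(\<lambda>n. measure_pmf.prob (random_grid n (p n)) {f. card (zero_rows n f) \<le> 1}) \<longlonglongrightarrow> 0"
proof -
  have "((\<lambda>y. (1 + exp 1 * y) * exp (- y)) \<longlongrightarrow> (0::real)) at_top" by real_asymp
  then have upper: "(\<lambda>n. (1 + exp 1 * (real n * (1 - p n) ^ n)) * exp (- (real n * (1 - p n) ^ n))) \<longlonglongrightarrow> 0"
    using lim by (rule filterlim_compose)
  have "eventually (\<lambda>n. measure_pmf.prob (random_grid n (p n)) {f. card (zero_rows n f) \<le> 1}
      \<le> (1 + exp 1 * (real n * (1 - p n) ^ n)) * exp (- (real n * (1 - p n) ^ n))) sequentially"
    using eventually_ge_at_top[of 1]
  proof eventually_elim
    case (elim n)
    then show ?case
      using p[of n] by (subst prob_at_most_one_zero_row) (auto intro!: binomial_at_most_one_le_exp power_le_one)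
  qed
  then show ?thesis
    by (rule tendsto_sandwich[OF _ _ tendsto_const upper, rotated]) simp
qed

text \<open>For \<open>c n \<le> 0\<close> the mean is at least \<open>exp (- c n)\<close> up to the factor \<open>exp (- 2 * (ln n) ^ 2 / n)\<close>.\<close>

lemma mean_zero_rows_at_top:
  fixes p c :: "nat \<Rightarrow> real"
  assumes p: "\<And>n. n \<ge> 1 \<Longrightarrow> 0 \<le> p n" "\<And>n. n \<ge> 1 \<Longrightarrow> p n \<le> 1 / 2"
    and np: "\<And>n. n \<ge> 1 \<Longrightarrow> real n * p n = ln (real n) + c n"
    and c: "filterlim c at_bot sequentially"
  shows "filterlim (\<lambda>n. real n * (1 - p n) ^ n) at_top sequentially"
proof -
  have "(\<lambda>n. - (2 * (ln (real n) ^ 2 / real n))) \<longlonglongrightarrow> 0" by real_asymp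
  then have "filterlim (\<lambda>n. - (2 * (ln (real n) ^ 2 / real n)) + - c n) at_top sequentially"
    using c by (intro filterlim_tendsto_add_at_top) (auto simp: filterlim_uminus_at_top)
  then have "filterlim (\<lambda>n. exp (- (2 * (ln (real n) ^ 2 / real n)) + - c n)) at_top sequentially"
    by (rule filterlim_compose[OF exp_at_top])
  moreover have "eventually (\<lambda>n. exp (- (2 * (ln (real n) ^ 2 / real n)) + - c n) \<le> real n * (1 - p n) ^ n) sequentially"
  proof -
    have "eventually (\<lambda>n. c n \<le> 0) sequentially"
      using c by (simp add: filterlim_at_bot)
    then show ?thesis
      using eventually_ge_at_top[of 1]
    proof eventually_elim
      case (elim n)
      have pn: "0 \<le> p n" "p n \<le> 1 / 2" using p elim by auto
      have n0: "0 < real n" using elim by simp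
      have "\<bar>ln (1 + (- p n)) - (- p n)\<bar> \<le> 2 * (- p n) ^ 2"
        using pn by (intro abs_ln_one_plus_x_minus_x_bound) auto
      then have "- p n - 2 * p n ^ 2 \<le> ln (1 - p n)" by simp
      then have "real n * (- p n - 2 * p n ^ 2) \<le> real n * ln (1 - p n)"
        by (intro mult_left_mono) auto
      then have "- (ln (real n) + c n) - 2 * (real n * p n ^ 2) \<le> real n * ln (1 - p n)"
        using np[of n] elim by (simp add: algebra_simps)
      moreover have "real n * p n ^ 2 \<le> ln (real n) ^ 2 / real n"
      proof -
        have "(real n * p n) ^ 2 \<le> ln (real n) ^ 2"
          using mult_nonneg_nonneg[of "real n" "p n"] pn np[of n] elim by (intro power_mono) auto
        then have "(real n * p n) ^ 2 / real n \<le> ln (real n) ^ 2 / real n"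
          by (intro divide_right_mono) auto
        then show ?thesis using n0 by (simp add: power2_eq_square mult.left_commute)
      qed
      ultimately have "- (2 * (ln (real n) ^ 2 / real n)) + - c n \<le> ln (real n) + real n * ln (1 - p n)"
        by linarith
      then have "exp (- (2 * (ln (real n) ^ 2 / real n)) + - c n) \<le> exp (ln (real n) + real n * ln (1 - p n))"
        by simp
      also have "\<dots> = real n * (1 - p n) ^ n"
        using n0 pn by (simp add: exp_add exp_of_nat_mult)
      finally show ?case .
    qed
  qed
  ultimately show ?thesis by (rule filterlim_at_top_mono)
qed

lemma mean_zero_rows_limit:
  fixes p c :: "nat \<Rightarrow> real"
  assumes np: "\<And>n. n \<ge> 1 \<Longrightarrow> real n * p n = ln (real n) + c n"
    and c: "c \<longlonglongrightarrow> \<gamma>"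
  shows "(\<lambda>n. real n * (1 - p n) ^ (n - s)) \<longlonglongrightarrow> exp (- \<gamma>)"
proof -
  have l: "(\<lambda>n. ln (real n) / real n) \<longlonglongrightarrow> 0" "(\<lambda>n. 1 / real n) \<longlonglongrightarrow> 0"
      "(\<lambda>n. ln (real n) ^ 2 / real n) \<longlonglongrightarrow> 0"
    by real_asymp+
  have p_eq: "p n = ln (real n) / real n + c n * (1 / real n)" if "n \<ge> 1" for n
    using np[OF that] that by (simp add: field_simps)
  have "(\<lambda>n. ln (real n) / real n + c n * (1 / real n)) \<longlonglongrightarrow> 0 + \<gamma> * 0"
    by (intro tendsto_add tendsto_mult c l)
  then have "(\<lambda>n. ln (real n) / real n + c n * (1 / real n)) \<longlonglongrightarrow> 0" by simp
  then have p0: "p \<longlonglongrightarrow> 0"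
    by (rule Lim_transform_eventually)
      (rule eventually_mono[OF eventually_ge_at_top[of 1]], simp add: p_eq)
  have "(\<lambda>n. ln (real n) ^ 2 / real n + 2 * c n * (ln (real n) / real n) + c n ^ 2 * (1 / real n))
      \<longlonglongrightarrow> 0 + 2 * \<gamma> * 0 + \<gamma> ^ 2 * 0"
    by (intro tendsto_add tendsto_mult tendsto_power tendsto_const c l)
  moreover have "eventually (\<lambda>n. ln (real n) ^ 2 / real n + 2 * c n * (ln (real n) / real n) + c n ^ 2 * (1 / real n)
      = real n * p n ^ 2) sequentially"
    using eventually_ge_at_top[of 1]
  proof eventually_elim
    case (elim n)
    have "real n * p n ^ 2 = (real n * p n) ^ 2 / real n"
      using elim by (simp add: power2_eq_square)
    then show ?case
      unfolding np[OF elim] by (simp add: power2_sum add_divide_distrib)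
  qed
  ultimately have sq: "(\<lambda>n. real n * p n ^ 2) \<longlonglongrightarrow> 0"
    by (auto elim: Lim_transform_eventually)
  have "eventually (\<lambda>n. \<bar>p n\<bar> < 1 / 2) sequentially"
    using tendsto_rabs_zero[OF p0] by (rule order_tendstoD) auto
  then have half: "eventually (\<lambda>n. \<bar>p n\<bar> \<le> 1 / 2) sequentially" "eventually (\<lambda>n. p n < 1) sequentially"
    by (auto elim: eventually_mono)
  have lim: "(\<lambda>n. real n * p n - ln (real n)) \<longlonglongrightarrow> \<gamma>"
    using c by (rule Lim_transform_eventually)
      (rule eventually_mono[OF eventually_ge_at_top[of 1]], simp add: np)
  have "(\<lambda>n. exp (ln (real n)) * (1 - p n) ^ n) \<longlonglongrightarrow> exp (- \<gamma>)"
    by (rule power_one_minus_limit[OF half(1) sq lim])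
  then have "(\<lambda>n. real n * (1 - p n) ^ n) \<longlonglongrightarrow> exp (- \<gamma>)"
    by (rule Lim_transform_eventually)
      (use eventually_gt_at_top[of 0] in \<open>eventually_elim, simp\<close>)
  then show ?thesis by (rule power_diff_limit[OF _ p0 half(2)])
qed

lemma critical_limit_bounds: "0 < critical_limit \<gamma>" "critical_limit \<gamma> < 1"
proof -
  define \<mu> where "\<mu> = exp (- \<gamma>)"
  have \<mu>: "0 < \<mu>" by (simp add: \<mu>_def)
  have "1 + \<mu> < exp \<mu>"
    using exp_lower_Taylor_quadratic[of \<mu>] zero_less_power[OF \<mu>, of 2] \<mu> by linarith
  then have "(1 + \<mu>) * exp (- \<mu>) < 1"
    by (simp add: exp_minus field_simps)
  moreover have "0 < (1 + \<mu>) * exp (- \<mu>)" using \<mu> by (simp add: add_pos_pos)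
  ultimately show "0 < critical_limit \<gamma>" "critical_limit \<gamma> < 1"
    by (auto simp: critical_limit_def \<mu>_def intro: power_Suc_less_one power_less_one_iff[THEN iffD2])
qed

theorem corollary2:
  fixes p c :: "nat \<Rightarrow> real"
  assumes "\<And>n. n \<ge> 1 \<Longrightarrow> p n = 1 / real n * (ln (real n) + c n)"
    and "\<And>n. n \<ge> 1 \<Longrightarrow> 0 \<le> p n"
    and "\<And>n. n \<ge> 1 \<Longrightarrow> p n \<le> 1 / 2"
  shows "(filterlim c at_top sequentially \<longrightarrow>
      (\<lambda>n. measure_pmf.prob (random_matrix n (p n)) {M. strongly_reconstructible M}) \<longlonglongrightarrow> 1) \<and>
    (filterlim c at_bot sequentially \<longrightarrow>
      (\<lambda>n. measure_pmf.prob (random_matrix n (p n)) {M. \<not> strongly_reconstructible M}) \<longlonglongrightarrow> 1) \<and>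
    (\<forall>\<gamma>. c \<longlonglongrightarrow> \<gamma> \<longrightarrow>
      (\<lambda>n. measure_pmf.prob (random_matrix n (p n)) {M. strongly_reconstructible M})
        \<longlonglongrightarrow> critical_limit \<gamma> \<and>
      0 < critical_limit \<gamma> \<and> critical_limit \<gamma> < 1)"
proof (intro conjI impI allI)
  have np: "real n * p n = ln (real n) + c n" if "n \<ge> 1" for n
    using assms(1)[OF that] that by simp
  have p1: "p n \<le> 1" if "n \<ge> 1" for n
    using assms(3)[OF that] by simp
  let ?strong = "\<lambda>n. measure_pmf.prob (random_matrix n (p n)) {M. strongly_reconstructible M}"
  let ?few = "\<lambda>n. measure_pmf.prob (random_grid n (p n)) {f. few_zero_lines n f}"
  have reduce: "?strong \<longlonglongrightarrow> L"
    if few: "?few \<longlonglongrightarrow> L" and K: "eventually (\<lambda>n. - K \<le> c n) sequentially" for L K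
  proof -
    have "eventually (\<lambda>n. ln (real n) - K \<le> real n * p n) sequentially"
      using K eventually_ge_at_top[of 1] by eventually_elim (simp add: np)
    from tendsto_diff[OF few reconstructible_if_few_zero_lines_whp[OF assms(2,3) this]]
    show ?thesis by (simp add: prob_strongly_reconstructible)
  qed
  {
    assume c: "filterlim c at_top sequentially"
    have "?few \<longlonglongrightarrow> 1"
    proof (rule tendsto_sandwich[OF _ _ _ tendsto_const])
      have "((\<lambda>x. 1 - 2 * exp (- x)) \<longlongrightarrow> (1::real)) at_top" by real_asymp
      then show "(\<lambda>n. 1 - 2 * exp (- c n)) \<longlonglongrightarrow> 1"
        using c by (rule filterlim_compose)
      (* First moment: the expected numbers of zero rows and of zero columns are at most exp (- c n). *)
    show "eventually (\<lambda>n. 1 - 2 * exp (- c n) \<le> ?few n) sequentially"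
        using eventually_ge_at_top[of 1]
      proof eventually_elim
        case (elim n)
        have "?few n = 1 - measure_pmf.prob (random_grid n (p n)) {f. \<not> few_zero_lines n f}"
          by (simp flip: measure_pmf.prob_compl add: Compl_eq_Diff_UNIV[symmetric] Collect_neg_eq)
        moreover have "measure_pmf.prob (random_grid n (p n)) {f. \<not> few_zero_lines n f} \<le> 2 * (real n * (1 - p n) ^ n)"
          using elim by (intro prob_not_few_zero_lines_le assms p1)
        moreover have "real n * (1 - p n) ^ n \<le> real n * exp (- (p n * real n))"
          using elim assms(2) p1 by (intro mult_left_mono one_minus_power_le_exp) auto
        moreover have "real n * exp (- (p n * real n)) = exp (- c n)"
          using np[OF elim] elim by (simp add: mult.commute[of "p n"] exp_diff exp_minus exp_add field_simps)
        ultimately show ?case by linarith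
      qed
    qed auto
    moreover have "eventually (\<lambda>n. - 0 \<le> c n) sequentially"
      using c by (simp add: filterlim_at_top)
    ultimately show "?strong \<longlonglongrightarrow> 1" by (rule reduce)
  next
    assume c: "filterlim c at_bot sequentially"
    have "?strong \<longlonglongrightarrow> 0"
    proof (rule tendsto_sandwich[OF _ _ tendsto_const])
      show "(\<lambda>n. measure_pmf.prob (random_grid n (p n)) {f. card (zero_rows n f) \<le> 1}) \<longlonglongrightarrow> 0"
        by (intro at_most_one_zero_row_vanishes mean_zero_rows_at_top[OF _ _ _ c] assms p1 np)
      show "eventually (\<lambda>n. ?strong n \<le> measure_pmf.prob (random_grid n (p n)) {f. card (zero_rows n f) \<le> 1}) sequentially"
        unfolding prob_random_matrix
        using zero_lines_le_one_if_strongly_reconstructible(1)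
        by (intro always_eventually allI measure_pmf.finite_measure_mono) auto
    qed auto
    then have "(\<lambda>n. 1 - ?strong n) \<longlonglongrightarrow> 1 - 0"
      by (intro tendsto_diff tendsto_const)
    moreover have "1 - ?strong n = measure_pmf.prob (random_matrix n (p n)) {M. \<not> strongly_reconstructible M}" for n
      by (simp flip: measure_pmf.prob_compl add: Compl_eq_Diff_UNIV[symmetric] Collect_neg_eq)
    ultimately show "(\<lambda>n. measure_pmf.prob (random_matrix n (p n)) {M. \<not> strongly_reconstructible M}) \<longlonglongrightarrow> 1"
      by simp
  next
    fix \<gamma> assume c: "c \<longlonglongrightarrow> \<gamma>"
    have "?few \<longlonglongrightarrow> critical_limit \<gamma>"
      unfolding critical_limit_def
      by (intro prob_few_zero_lines_limit mean_zero_rows_limit[OF _ c] assms p1 np)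
    moreover have "eventually (\<lambda>n. \<gamma> - 1 < c n) sequentially"
      using c by (rule order_tendstoD) simp
    then have "eventually (\<lambda>n. - (1 - \<gamma>) \<le> c n) sequentially"
      by (auto elim: eventually_mono)
    ultimately show "?strong \<longlonglongrightarrow> critical_limit \<gamma>" by (rule reduce)
  }
qed (rule critical_limit_bounds)+

end
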